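(* Let $f(z)=\sum_{j\ge1}a(j)z^j$ be a formal power series with $a(j)\in\mathbb Z$, not identically zero; let $g(z)=\sum_{j\ge1}|a(j)|z^j$, let $j_0$ be the smallest $j$ with $a(j)\neq0$, and let $\rho_c$ be the radius of convergence of $g$ at $0$. For $r\ge1$ define $h(j,r)$ by $$H^{(r)}(z)=\frac1r\sum_{e\mid r}\mu(e)f(z^e)^{r/e}=\sum_{j=0}^\infty h(j,r)z^j.$$ Then (i) all $h(j,k)$ are integers, and as formal power series in $y,z$, $$1-yf(z)=\prod_{k=1}^{\infty}\prod_{j=kj_0}^{\infty}(1-z^jy^k)^{h(j,k)}.$$ (ii) For every fixed $\epsilon>0$, this identity holds (with the product absolutely convergent) for all complex $y,z$ with $|z|<\rho_c$ and $g(|z|)|y|<1-\epsilon$. (iii) If moreover $\rho_c>1/2$, $g(1/2)<1$ and $\sum_p g(1/p)$ converges, then for every Dirichlet character $\chi$, $$\prod_p\Bigl(1-\chi(p)f\bigl(\tfrac1p\bigr)\Bigr)=\prod_{k=1}^{\infty}\prod_{j=kj_0}^{\infty}L(j,\chi^k)^{-h(j,k)}.$$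
   Context: $\mu$ is the Möbius function; products over $p$ run over primes; $L(s,\chi)=\sum_{n\ge1}\chi(n)n^{-s}$ is the Dirichlet L-series of the Dirichlet character $\chi$. *)

theory Defs
  imports "HOL-Analysis.Analysis" "HOL-Computational_Algebra.Computational_Algebra"
begin

definition moebius_mu :: "nat \<Rightarrow> int" where
  "moebius_mu n = (if squarefree n then (-1) ^ card (prime_factors n) else 0)"

(* f as a formal power series (rational coefficients; a :: nat => int, a 0 = 0 assumed) *)
definition f_fps :: "(nat \<Rightarrow> int) \<Rightarrow> rat fps" where
  "f_fps a = Abs_fps (\<lambda>j. of_int (a j))"

definition H_fps :: "(nat \<Rightarrow> int) \<Rightarrow> nat \<Rightarrow> rat fps" where
  "H_fps a r = fps_const (1 / of_nat r) *
     (\<Sum>e\<in>{e. e dvd r}. fps_const (of_int (moebius_mu e)) * (f_fps a oo (fps_X ^ e)) ^ (r div e))"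

definition h_coeff :: "(nat \<Rightarrow> int) \<Rightarrow> nat \<Rightarrow> nat \<Rightarrow> rat" where
  "h_coeff a j r = fps_nth (H_fps a r) j"

(* the integer value of h(j,r) (part (i) of the theorem asserts h(j,r) is an integer) *)
definition h_int :: "(nat \<Rightarrow> int) \<Rightarrow> nat \<Rightarrow> nat \<Rightarrow> int" where
  "h_int a j r = \<lfloor>h_coeff a j r\<rfloor>"

definition j0 :: "(nat \<Rightarrow> int) \<Rightarrow> nat" where
  "j0 a = (LEAST j. a j \<noteq> 0)"

definition g_fun :: "(nat \<Rightarrow> int) \<Rightarrow> real \<Rightarrow> real" where
  "g_fun a x = (\<Sum>j. of_int \<bar>a j\<bar> * x ^ j)"

definition f_fun :: "(nat \<Rightarrow> int) \<Rightarrow> complex \<Rightarrow> complex" where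
  "f_fun a z = (\<Sum>j. of_int (a j) * z ^ j)"

definition rho_c :: "(nat \<Rightarrow> int) \<Rightarrow> ereal" where
  "rho_c a = conv_radius (\<lambda>j. real_of_int \<bar>a j\<bar>)"

(* Bivariate formal power series: outer variable z, coefficients are formal
   power series in y.  Here 1 - y f(z): *)
definition one_minus_yf :: "(nat \<Rightarrow> int) \<Rightarrow> rat fps fps" where
  "one_minus_yf a = 1 - Abs_fps (\<lambda>j. fps_const (of_int (a j)) * fps_X)"

definition formal_factor :: "(nat \<Rightarrow> int) \<Rightarrow> nat \<Rightarrow> nat \<Rightarrow> rat fps fps" where
  "formal_factor a k j = (1 - fps_const (fps_X ^ k) * fps_X ^ j) powi h_int a j k"

definition cfactor :: "(nat \<Rightarrow> int) \<Rightarrow> complex \<Rightarrow> complex \<Rightarrow> nat \<Rightarrow> nat \<Rightarrow> complex" where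
  "cfactor a z y k j = (1 - z ^ j * y ^ k) powi h_int a j k"

definition dirichlet_character :: "nat \<Rightarrow> (nat \<Rightarrow> complex) \<Rightarrow> bool" where
  "dirichlet_character q chi \<longleftrightarrow> q \<ge> 1 \<and> (\<forall>n. chi (n + q) = chi n) \<and>
     (\<forall>m n. chi (m * n) = chi m * chi n) \<and> chi 1 = 1 \<and>
     (\<forall>n. chi n = 0 \<longleftrightarrow> \<not> coprime n q)"

definition L_fun :: "nat \<Rightarrow> (nat \<Rightarrow> complex) \<Rightarrow> complex" where
  "L_fun s chi = (\<Sum>n. chi (Suc n) / of_nat (Suc n) ^ s)"

end

theory Submission
  imports Defs
begin

text \<open>Moebius inversion turns the definition of $H^{(r)}$ into
  $\sum_{m \mid \gcd(n,r)} \frac1m h(n/m, r/m) = \frac1r [z^n] f(z)^r$, which is the coefficient of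
  $z^n y^r$ in the logarithm of the claimed product identity.

  Formally, this is used through the logarithmic derivative in $z$. Dividing $1 - y f(z)$ by the
  factors with $j < N$ leaves $1 - z^N \sum_r h(N,r) y^r + O(z^{N+1})$, and this quotient has integer
  coefficients as soon as the earlier exponents are integers; so integrality and the product
  identity come out of a single induction on $N$.

  Analytically, $|h(j,k)| \le [z^j] g(z)^k$ makes the family of logarithms absolutely summable, with
  sum over $j$ of size $(g(|z|)|y|)^k$. For the Euler product, put $z = 1/p$, $y = \chi(p)$ and
  exchange the absolutely convergent sums over $p$ and over $(k,j)$. Convergence of
  $\sum_p g(1/p)$ forces $j_0 \ge 2$, so only $L(j, \chi^k)$ with $j \ge 2$ occur.\<close>

section \<open>Moebius inversion and the coefficients $h(j,k)$\<close>

text \<open>The coefficient ring Q[[y]] of the outer series is not a field, so the formal part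
  avoids quotients: the relation z F' = F E stands for E = z F' / F and turns products into sums.
  The exponent \<open>h_int\<close> is a floor, hence an integer by type, but its equality with
  h(j,k) is known only for the j already treated; therefore integrality has to travel with the
  product identity. The bound on |h(j,k)| rests on integrality of a(j). A nonzero coefficient of g^k
  is at least 1, so the coefficients do not decrease from (k, j) to (e k, e j). Every term of the
  Moebius sum is then at most the term e = 1, and the prefactor 1/k absorbs the number of divisors.
  The same lower bound 1 forces |z^j y^k| < 1 wherever h(j,k) is nonzero, which makes the principal
  logarithm of each relevant factor available. In the Euler product all estimates are uniform in p,
  because 1/p <= 1/2 and g is increasing.\<close>

lemma moebius_mu_prime_mult:
  assumes p: "prime p" and "\<not> p dvd e"
  shows "moebius_mu (p * e) = - moebius_mu e"
proof -
  have e0: "e \<noteq> 0" using assms by (metis dvd_0_right)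
  have cop: "coprime p e" using p assms(2) by (rule prime_imp_coprime)
  have "squarefree (p * e) \<longleftrightarrow> squarefree e"
    using squarefree_mult_coprime[OF cop] squarefree_prime[OF p] squarefree_multD by blast
  moreover have "card (prime_factors (p * e)) = Suc (card (prime_factors e))"
  proof -
    have "prime_factors (p * e) = insert p (prime_factors e)"
      using p e0 by (subst prime_factors_product) (auto simp: prime_prime_factors)
    moreover have "p \<notin> prime_factors e" using assms(2) by auto
    ultimately show ?thesis by simp
  qed
  ultimately show ?thesis by (simp add: moebius_mu_def)
qed

text \<open>For a prime p dividing n, the squarefree divisors pair off as d and p d with d not
  divisible by p, and the two values cancel. Divisors outside these pairs are not
  squarefree.\<close>

lemma sum_moebius_mu_divisors:
  assumes "n > 0"
  shows "(\<Sum>d | d dvd n. moebius_mu d) = (if n = 1 then 1 else 0)"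
proof (cases "n = 1")
  case True
  then show ?thesis by (simp add: moebius_mu_def)
next
  case False
  then obtain p where p: "prime p" "p dvd n" using prime_factor_nat by blast
  define A where "A = {d. d dvd n \<and> squarefree d \<and> \<not> p dvd d}"
  have fin: "finite {d. d dvd n}" using assms by (simp add: finite_divisors_nat)
  have A: "finite A" unfolding A_def by (rule finite_subset[OF _ fin]) auto
  have inj: "inj_on (\<lambda>d. p * d) A" using p by (auto simp: inj_on_def)
  have sub: "A \<union> (\<lambda>d. p * d) ` A \<subseteq> {d. d dvd n}"
    using p by (auto simp: A_def intro: divides_mult prime_imp_coprime)
  have zero: "moebius_mu d = 0" if d: "d dvd n" "d \<notin> A \<union> (\<lambda>d. p * d) ` A" for d
  proof (rule ccontr)
    assume "moebius_mu d \<noteq> 0"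
    then have sq: "squarefree d" by (auto simp: moebius_mu_def split: if_splits)
    then have "p dvd d" using d by (auto simp: A_def)
    then obtain e where e: "d = p * e" by (elim dvdE)
    have "\<not> p dvd e"
    proof
      assume "p dvd e"
      then have "p ^ 2 dvd d" by (simp add: e power2_eq_square)
      then show False using sq p(1) by (auto simp: squarefree_def)
    qed
    then have "e \<in> A" using d(1) e sq squarefree_multD(2)[of p e] by (auto simp: A_def dest: dvd_mult_right)
    then show False using d(2) e by auto
  qed
  have "(\<Sum>d | d dvd n. moebius_mu d) = (\<Sum>d\<in>A \<union> (\<lambda>d. p * d) ` A. moebius_mu d)"
    using fin sub zero by (intro sum.mono_neutral_right) auto
  also have "\<dots> = (\<Sum>d\<in>A. moebius_mu d) + (\<Sum>d\<in>(\<lambda>d. p * d) ` A. moebius_mu d)"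
    using A by (intro sum.union_disjoint) (auto simp: A_def)
  also have "(\<Sum>d\<in>(\<lambda>d. p * d) ` A. moebius_mu d) = (\<Sum>d\<in>A. - moebius_mu d)"
    by (subst sum.reindex[OF inj]) (auto simp: A_def moebius_mu_prime_mult p intro!: sum.cong)
  finally show ?thesis using False by (simp add: sum_negf)
qed

text \<open>The coefficient of z^j in f(z)^k, kept as an integer so that the same numbers serve
  rational, real and complex series through \<open>fps_nth_power_of_int\<close>. Applied to the
  absolute values of a it gives the coefficients of g^k.\<close>

definition pcoef :: "(nat \<Rightarrow> int) \<Rightarrow> nat \<Rightarrow> nat \<Rightarrow> int" where
  "pcoef a k j = fps_nth (Abs_fps a ^ k) j"

lemma pcoef_Suc: "pcoef a (Suc k) j = (\<Sum>i=0..j. a i * pcoef a k (j - i))"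
  by (simp add: pcoef_def fps_mult_nth)

lemma pcoef_0: "pcoef a 0 j = (if j = 0 then 1 else 0)"
  by (simp add: pcoef_def)

lemma pcoef_1: "pcoef a (Suc 0) j = a j"
  by (simp add: pcoef_def)

lemma fps_nth_power_of_int:
  "fps_nth ((Abs_fps (\<lambda>j. of_int (a j)) :: 'b::comm_ring_1 fps) ^ k) j = of_int (pcoef a k j)"
  by (induction k arbitrary: j) (auto simp: pcoef_0 pcoef_Suc fps_mult_nth)

lemma abs_pcoef_le: "\<bar>pcoef a k j\<bar> \<le> pcoef (\<lambda>j. \<bar>a j\<bar>) k j"
proof (induction k arbitrary: j)
  case 0
  then show ?case by (simp add: pcoef_0)
next
  case (Suc k)
  have "\<bar>pcoef a (Suc k) j\<bar> \<le> (\<Sum>i=0..j. \<bar>a i * pcoef a k (j - i)\<bar>)"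
    unfolding pcoef_Suc by (rule sum_abs)
  also have "\<dots> \<le> (\<Sum>i=0..j. \<bar>a i\<bar> * pcoef (\<lambda>j. \<bar>a j\<bar>) k (j - i))"
    by (intro sum_mono) (simp add: abs_mult mult_left_mono Suc.IH)
  finally show ?case by (simp add: pcoef_Suc)
qed

lemma pcoef_abs_nonneg: "0 \<le> pcoef (\<lambda>j. \<bar>a j\<bar>) k j"
  using abs_pcoef_le[of a k j] by linarith

lemma pcoef_eq_0:
  assumes "j < k * j0 a"
  shows "pcoef a k j = 0"
  using assms
proof (induction k arbitrary: j)
  case (Suc k)
  have "a i * pcoef a k (j - i) = 0" if "i \<le> j" for i
  proof (cases "i < j0 a")
    case True
    then show ?thesis unfolding j0_def using not_less_Least by auto
  next
    case False
    then show ?thesis using Suc that by auto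
  qed
  then show ?case unfolding pcoef_Suc by (intro sum.neutral) simp
qed simp

text \<open>With G = g^k, the coefficient c of z^j in G is a nonnegative integer. If c = 0 nothing
  is claimed beyond positivity; otherwise c >= 1, and the single convolution term c * [z^(e j)] G^e
  already carries the bound from e to e + 1.\<close>

lemma pcoef_abs_mult_le:
  assumes "e \<ge> 1"
  shows "pcoef (\<lambda>j. \<bar>a j\<bar>) k j \<le> pcoef (\<lambda>j. \<bar>a j\<bar>) (e * k) (e * j)"
proof -
  define b where "b = (\<lambda>j. \<bar>a j\<bar>)"
  define G where "G = Abs_fps b ^ k"
  have nonneg: "0 \<le> fps_nth (G ^ e) i" for e i
    using pcoef_abs_nonneg[of a "k * e" i] by (simp add: G_def b_def pcoef_def power_mult)
  have "fps_nth G j \<le> fps_nth (G ^ e) (e * j)"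
    using assms
  proof (induction e rule: dec_induct)
    case (step e)
    show ?case
    proof (cases "fps_nth G j = 0")
      case True
      show ?thesis unfolding True by (rule nonneg)
    next
      case False
      then have g1: "1 \<le> fps_nth G j" using nonneg[of 1 j] by simp
      have "fps_nth G j \<le> fps_nth G j * fps_nth (G ^ e) (e * j)"
        using g1 step.IH by (intro mult_le_cancel_left1[THEN iffD2]) auto
      also have "\<dots> \<le> (\<Sum>i=0..Suc e * j. fps_nth G i * fps_nth (G ^ e) (Suc e * j - i))"
        using member_le_sum[of j "{0..Suc e * j}" "\<lambda>i. fps_nth G i * fps_nth (G ^ e) (Suc e * j - i)"]
          nonneg[of 1] nonneg[of e] by simp
      finally show ?thesis by (simp add: fps_mult_nth)
    qed
  qed simp
  moreover have "G ^ e = Abs_fps b ^ (e * k)"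
    unfolding G_def power_mult[symmetric] by (subst mult.commute) (rule refl)
  ultimately show ?thesis unfolding pcoef_def b_def[symmetric] G_def by (simp only:)
qed

lemma fps_nth_compose_X_power:
  fixes F :: "'a::idom fps"
  assumes "e \<ge> 1"
  shows "fps_nth (F oo fps_X ^ e) n = (if e dvd n then fps_nth F (n div e) else 0)"
proof -
  have "fps_nth (F oo fps_X ^ e) n = (\<Sum>i=0..n. if n = e * i then fps_nth F i else 0)"
    unfolding fps_compose_nth by (intro sum.cong) (auto simp flip: power_mult)
  also have "\<dots> = (\<Sum>i\<in>{0..n} \<inter> {i. n = e * i}. fps_nth F i)"
    by (simp add: sum.inter_restrict)
  also have "{0..n} \<inter> {i. n = e * i} = (if e dvd n then {n div e} else {})"
    using assms by (auto simp: div_le_dividend)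
  finally show ?thesis by auto
qed

lemma h_coeff_eq:
  assumes "k \<ge> 1"
  shows "h_coeff a j k =
    (\<Sum>e | e dvd k \<and> e dvd j. of_int (moebius_mu e * pcoef a (k div e) (j div e))) / of_nat k"
proof -
  have fin: "finite {e. e dvd k}" using assms by (simp add: finite_divisors_nat)
  have "fps_nth (fps_const (of_int (moebius_mu e)) * (f_fps a oo fps_X ^ e) ^ (k div e)) j
      = (if e dvd j then of_int (moebius_mu e * pcoef a (k div e) (j div e)) else 0)"
    if "e dvd k" for e
  proof -
    have e: "e \<ge> 1" using that assms by (cases e) auto
    then have "(f_fps a oo fps_X ^ e) ^ (k div e) = f_fps a ^ (k div e) oo fps_X ^ e"
      by (intro fps_compose_power) simp
    then show ?thesis
      using e by (simp add: fps_nth_compose_X_power f_fps_def fps_nth_power_of_int)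
  qed
  then have "h_coeff a j k =
      (\<Sum>e | e dvd k. if e dvd j then of_int (moebius_mu e * pcoef a (k div e) (j div e)) else 0) / of_nat k"
    by (simp add: h_coeff_def H_fps_def fps_sum_nth)
  also have "(\<Sum>e | e dvd k. if e dvd j then of_int (moebius_mu e * pcoef a (k div e) (j div e)) else 0)
      = (\<Sum>e\<in>{e. e dvd k} \<inter> {e. e dvd j}. of_int (moebius_mu e * pcoef a (k div e) (j div e)) :: rat)"
    using sum.inter_restrict[OF fin, of "\<lambda>e. of_int (moebius_mu e * pcoef a (k div e) (j div e)) :: rat" "{e. e dvd j}"]
    by simp
  finally show ?thesis by (simp add: Int_def)
qed

lemma h_coeff_eq_0:
  assumes "k \<ge> 1" "j < k * j0 a"
  shows "h_coeff a j k = 0"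
proof -
  have "pcoef a (k div e) (j div e) = 0" if "e dvd k" "e dvd j" for e
  proof (rule pcoef_eq_0)
    have "e > 0" using that assms by (cases e) auto
    then show "j div e < k div e * j0 a"
      using assms that by (auto elim!: dvdE)
  qed
  then show ?thesis using assms by (auto simp: h_coeff_eq intro!: sum.neutral)
qed

text \<open>There are at most k common divisors e, and \<open>pcoef_abs_mult_le\<close> bounds each
  term by the one that e = 1 gives for g; the division by k removes the count.\<close>

lemma abs_h_coeff_le:
  assumes "k \<ge> 1"
  shows "\<bar>h_coeff a j k\<bar> \<le> of_int (pcoef (\<lambda>j. \<bar>a j\<bar>) k j)"
proof -
  let ?D = "{e. e dvd k \<and> e dvd j}" and ?B = "pcoef (\<lambda>j. \<bar>a j\<bar>)"
  have D: "?D \<subseteq> {1..k}" using assms by (auto intro: dvd_imp_le Suc_leI dest: dvd_pos_nat)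
  have "\<bar>moebius_mu e * pcoef a (k div e) (j div e)\<bar> \<le> ?B k j" if "e \<in> ?D" for e
  proof -
    have "\<bar>moebius_mu e * pcoef a (k div e) (j div e)\<bar> \<le> \<bar>pcoef a (k div e) (j div e)\<bar>"
      by (auto simp: moebius_mu_def abs_mult power_abs)
    also have "\<dots> \<le> ?B (k div e) (j div e)" by (rule abs_pcoef_le)
    also have "\<dots> \<le> ?B (e * (k div e)) (e * (j div e))"
      using that D by (intro pcoef_abs_mult_le) auto
    finally show ?thesis using that by simp
  qed
  then have "\<bar>\<Sum>e\<in>?D. moebius_mu e * pcoef a (k div e) (j div e)\<bar> \<le> of_nat (card ?D) * ?B k j"
    by (intro order.trans[OF sum_abs] sum_bounded_above)
  also have "\<dots> \<le> of_nat k * ?B k j"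
    using card_mono[OF _ D] by (intro mult_right_mono pcoef_abs_nonneg) auto
  finally have "\<bar>of_int (\<Sum>e\<in>?D. moebius_mu e * pcoef a (k div e) (j div e)) :: rat\<bar> \<le> of_int (of_nat k * ?B k j)"
    by linarith
  then show ?thesis
    using assms unfolding h_coeff_eq[OF assms] by (simp add: abs_divide divide_le_eq mult.commute)
qed

text \<open>The coefficient form of $\sum_{m \mid r} \frac1m H^{(r/m)}(z^m) = \frac1r f(z)^r$, the
  identity behind every part of the theorem.\<close>
lemma sum_h_coeff_divisors:
  assumes k: "k \<ge> 1"
  shows "(\<Sum>m | m dvd k \<and> m dvd j. h_coeff a (j div m) (k div m) / of_nat m) = of_int (pcoef a k j) / of_nat k"
proof -
  let ?D = "{m. m dvd k \<and> m dvd j}"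
  define T where "T = (\<lambda>m e. of_int (moebius_mu e * pcoef a (k div (m*e)) (j div (m*e))) :: rat)"
  have pos: "m > 0" if "m dvd k" for m using that k by (cases m) auto
  have fin: "finite ?D" using k by (intro finite_subset[OF _ finite_divisors_nat[of k]]) auto
  have step: "h_coeff a (j div m) (k div m) / of_nat m = (\<Sum>e | m * e \<in> ?D. T m e) / of_nat k"
    if m: "m \<in> ?D" for m
  proof -
    obtain k' j' where kj: "k = m * k'" "j = m * j'" using m by (auto elim!: dvdE)
    have k': "k' \<ge> 1" "m > 0" using k kj by (auto intro: Suc_leI)
    have "{e. m * e \<in> ?D} = {e. e dvd k' \<and> e dvd j'}" using k' by (auto simp: kj)
    then show ?thesis using k' by (simp add: h_coeff_eq kj T_def div_mult2_eq)
  qed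
  have "(\<Sum>m\<in>?D. h_coeff a (j div m) (k div m) / of_nat m) = (\<Sum>m\<in>?D. \<Sum>e | m * e \<in> ?D. T m e) / of_nat k"
    by (simp add: step sum_divide_distrib del: mem_Collect_eq)
  also have "(\<Sum>m\<in>?D. \<Sum>e | m * e \<in> ?D. T m e) = (\<Sum>(m,e)\<in>Sigma ?D (\<lambda>m. {e. m * e \<in> ?D}). T m e)"
  proof (rule sum.Sigma[OF fin], rule ballI)
    fix m assume "m \<in> ?D"
    show "finite {e. m * e \<in> ?D}"
      by (rule finite_subset[OF _ fin]) (auto dest: dvd_mult_right)
  qed
  \<comment> \<open>Substituting d = m e: the \<open>pcoef\<close> factor depends on m and e only
    through d, so the inner sum becomes the Moebius sum over the divisors of d.\<close>
  also have "\<dots> = (\<Sum>(d,e)\<in>Sigma ?D (\<lambda>d. {e. e dvd d}). of_int (moebius_mu e * pcoef a (k div d) (j div d)))"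
    using pos by (intro sum.reindex_bij_witness[of _ "\<lambda>(d,e). (d div e, e)" "\<lambda>(m,e). (m*e, e)"])
      (force simp: T_def intro: dvd_trans dest: dvd_mult_left)+
  also have "\<dots> = (\<Sum>d\<in>?D. \<Sum>e | e dvd d. of_int (moebius_mu e * pcoef a (k div d) (j div d)))"
    using pos by (intro sum.Sigma[symmetric] fin ballI) (auto intro: finite_divisors_nat)
  also have "\<dots> = (\<Sum>d\<in>?D. of_int (\<Sum>e | e dvd d. moebius_mu e) * of_int (pcoef a (k div d) (j div d)))"
    by (simp add: sum_distrib_right)
  also have "\<dots> = (\<Sum>d\<in>?D. if d = 1 then of_int (pcoef a k j) else 0)"
    using pos by (intro sum.cong) (auto simp: sum_moebius_mu_divisors)
  also have "\<dots> = of_int (pcoef a k j)" using fin by (subst sum.delta) auto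
  finally show ?thesis .
qed

section \<open>The formal product\<close>

text \<open>E plays the role of z F' / F, stated without division. The factor z keeps degrees
  aligned: the coefficient of z^n in E is n times that of log F.\<close>

definition fps_log_deriv :: "'b::comm_ring_1 fps \<Rightarrow> 'b fps \<Rightarrow> bool" where
  "fps_log_deriv F E \<longleftrightarrow> fps_X * fps_deriv F = F * E"

lemma fps_log_deriv_1: "fps_log_deriv 1 0"
  by (simp add: fps_log_deriv_def)

lemma fps_log_deriv_mult:
  assumes "fps_log_deriv F E" "fps_log_deriv G E'"
  shows "fps_log_deriv (F * G) (E + E')"
proof -
  have "fps_X * fps_deriv (F * G) = F * (fps_X * fps_deriv G) + (fps_X * fps_deriv F) * G"
    by (simp add: algebra_simps)
  also have "\<dots> = F * (G * E') + (F * E) * G" using assms by (simp only: fps_log_deriv_def)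
  also have "\<dots> = F * G * (E + E')" by (simp add: algebra_simps)
  finally show ?thesis by (simp only: fps_log_deriv_def)
qed

lemma fps_log_deriv_prod:
  assumes "\<And>x. x \<in> S \<Longrightarrow> fps_log_deriv (F x) (E x)"
  shows "fps_log_deriv (\<Prod>x\<in>S. F x) (\<Sum>x\<in>S. E x)"
  using assms by (induction S rule: infinite_finite_induct) (auto simp: fps_log_deriv_1 fps_log_deriv_mult)

lemma fps_log_deriv_power:
  assumes "fps_log_deriv F E"
  shows "fps_log_deriv (F ^ n) (of_nat n * E)"
  using fps_log_deriv_prod[of "{..<n}" "\<lambda>_. F" "\<lambda>_. E"] assms by simp

lemma fps_log_deriv_inverse:
  assumes E: "fps_log_deriv F E" and FG: "F * G = 1"
  shows "fps_log_deriv G (- E)"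
proof -
  have "F * (fps_X * fps_deriv G) + (fps_X * fps_deriv F) * G = fps_X * fps_deriv (F * G)"
    by (simp add: algebra_simps)
  then have "F * (fps_X * fps_deriv G) + (F * E) * G = 0"
    using E by (simp add: FG fps_log_deriv_def)
  then have "G * (F * (fps_X * fps_deriv G) + (F * E) * G) = 0" by simp
  then have "(F * G) * (fps_X * fps_deriv G) + (F * G) * (G * E) = 0"
    by (simp add: algebra_simps)
  then show ?thesis by (simp add: FG fps_log_deriv_def eq_neg_iff_add_eq_0)
qed

lemma fps_log_deriv_powi:
  fixes F :: "'b::{comm_ring_1,inverse} fps"
  assumes "fps_log_deriv F E" "F * inverse F = 1"
  shows "fps_log_deriv (F powi n) (of_int n * E)"
proof (cases "n \<ge> 0")
  case True
  then show ?thesis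
    using fps_log_deriv_power[OF assms(1), of "nat n"] by (simp add: power_int_def)
next
  case False
  then show ?thesis
    using fps_log_deriv_power[OF fps_log_deriv_inverse[OF assms], of "nat (-n)"]
    by (simp add: power_int_def)
qed

text \<open>Comparing coefficients of z^n gives n V_n = sum of V_i E_(n-i) over i <= n. If E starts
  at degree N, the right side is 0 for n < N, and for n = N only V_0 E_N survives; characteristic 0
  cancels n.\<close>

lemma fps_log_deriv_imp_nth:
  fixes V :: "'b::{idom,semiring_char_0} fps"
  assumes V: "fps_log_deriv V E" "fps_nth V 0 = 1" and E: "\<And>n. n < N \<Longrightarrow> fps_nth E n = 0" and N: "N \<ge> 1"
  shows "\<And>n. 0 < n \<Longrightarrow> n < N \<Longrightarrow> fps_nth V n = 0" and "of_nat N * fps_nth V N = fps_nth E N"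
proof -
  have eq: "of_nat n * fps_nth V n = (\<Sum>i=0..n. fps_nth V i * fps_nth E (n - i))" for n
  proof -
    have "of_nat n * fps_nth V n = fps_nth (fps_X * fps_deriv V) n" by (cases n) simp_all
    also have "\<dots> = fps_nth (V * E) n" using V(1) by (simp only: fps_log_deriv_def)
    finally show ?thesis by (simp only: fps_mult_nth)
  qed
  show "fps_nth V n = 0" if "0 < n" "n < N" for n
    using eq[of n] that E by simp
  have "(\<Sum>i=0..N. fps_nth V i * fps_nth E (N - i)) = (\<Sum>i\<in>{0}. fps_nth V i * fps_nth E (N - i))"
    using E N by (intro sum.mono_neutral_right) auto
  then show "of_nat N * fps_nth V N = fps_nth E N" by (simp add: eq V(2))
qed

section \<open>The factors 1 - z^j y^k, their inverses and logarithmic derivatives\<close>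

definition yz_factor :: "nat \<Rightarrow> nat \<Rightarrow> rat fps fps" where
  "yz_factor k j = 1 - fps_const (fps_X ^ k) * fps_X ^ j"

lemma formal_factor_eq: "formal_factor a k j = yz_factor k j powi h_int a j k"
  by (simp add: formal_factor_def yz_factor_def)

lemma fps_nth_const_mult_X_power:
  fixes c :: "'b::comm_ring_1"
  shows "fps_nth (fps_const c * fps_X ^ j * F) n = (if n < j then 0 else c * fps_nth F (n - j))"
  by (simp add: mult.assoc fps_X_power_mult_nth)

lemma yz_factor_nth: "j \<ge> 1 \<Longrightarrow> fps_nth (yz_factor k j) n = (if n = 0 then 1 else if n = j then - (fps_X ^ k) else 0)"
  by (simp add: yz_factor_def)

text \<open>The inverse is the geometric series in z^j y^k. Only the constant coefficient 1 has to
  be inverted in Q[[y]]; the closed form then follows from uniqueness of inverses in a commutative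
  ring.\<close>

lemma inverse_yz_factor:
  assumes j: "j \<ge> 1"
  shows "yz_factor k j * inverse (yz_factor k j) = 1"
    and "inverse (yz_factor k j) = Abs_fps (\<lambda>n. if j dvd n then fps_X ^ (k * (n div j)) else 0)"
      (is "_ = ?G")
proof -
  have "fps_nth (yz_factor k j) 0 * inverse (fps_nth (yz_factor k j) 0) = 1"
    using j by (simp add: yz_factor_nth)
  then show 1: "yz_factor k j * inverse (yz_factor k j) = 1"
    unfolding fps_inverse_def by (rule fps_right_inverse)
  have "yz_factor k j * ?G = 1"
  proof (rule fps_ext)
    fix n
    have "fps_nth (yz_factor k j * ?G) n = fps_nth ?G n - (if n < j then 0 else fps_X ^ k * fps_nth ?G (n - j))"
      by (simp add: yz_factor_def left_diff_distrib fps_nth_const_mult_X_power)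
    also have "\<dots> = fps_nth 1 n"
    proof (cases "n < j")
      case True
      then have "j dvd n \<longleftrightarrow> n = 0" by (auto dest: dvd_imp_le)
      then show ?thesis using True by simp
    next
      case False
      then obtain m where m: "n = j + m" by (metis add_diff_inverse)
      show ?thesis using j unfolding m by (auto simp flip: power_add)
    qed
    finally show "fps_nth (yz_factor k j * ?G) n = fps_nth 1 n" .
  qed
  then have "inverse (yz_factor k j) = inverse (yz_factor k j) * (yz_factor k j * ?G)" by simp
  also have "\<dots> = (yz_factor k j * inverse (yz_factor k j)) * ?G" by (simp only: mult_ac)
  finally show "inverse (yz_factor k j) = ?G" by (simp only: 1 mult_1_left)
qed

lemma fps_powi_mult_powi_minus:
  fixes F :: "'b::{comm_ring_1,inverse} fps"
  assumes "F * inverse F = 1"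
  shows "F powi n * F powi (- n) = 1"
  using assms by (auto simp: power_int_def simp flip: power_mult_distrib) (simp add: mult.commute)

text \<open>The series congruent to 1 modulo z^j are closed under products and contain both the
  factor and its inverse, hence all its integer powers. This is the source of z-adic convergence: a
  factor with large j cannot disturb low coefficients.\<close>

lemma fps_nth_yz_factor_powi:
  assumes j: "j \<ge> 1" and n: "n < j"
  shows "fps_nth (yz_factor k j powi m) n = (if n = 0 then 1 else 0)"
proof -
  define U where "U = {F :: rat fps fps. \<forall>n<j. fps_nth F n = (if n = 0 then 1 else 0)}"
  have mult: "F * G \<in> U" if "F \<in> U" "G \<in> U" for F G
  proof -
    have "fps_nth (F * G) n = (if n = 0 then 1 else 0)" if "n < j" for n
    proof -
      have "fps_nth (F * G) n = (\<Sum>i=0..n. (if i = 0 then 1 else 0) * (if n - i = 0 then 1 else 0))"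
        unfolding fps_mult_nth using \<open>F \<in> U\<close> \<open>G \<in> U\<close> that by (intro sum.cong) (auto simp: U_def)
      also have "\<dots> = (\<Sum>i\<in>{0}. if n - i = 0 then 1 else 0)"
        by (intro sum.mono_neutral_cong_right) auto
      finally show ?thesis by simp
    qed
    then show ?thesis by (simp add: U_def)
  qed
  have pow: "F ^ m \<in> U" if "F \<in> U" for F m
    by (induction m) (auto simp: mult that, simp add: U_def)
  have "yz_factor k j \<in> U" "inverse (yz_factor k j) \<in> U"
    using j by (auto simp: U_def yz_factor_nth inverse_yz_factor dest: dvd_imp_le)
  then have "yz_factor k j powi m \<in> U" by (simp add: power_int_def pow)
  then show ?thesis using n by (simp add: U_def)
qed

text \<open>Membership in the subring Z[[y]][[z]]. The ambient ring stays rational because the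
  logarithmic derivatives have denominators r.\<close>

definition int_coeffs :: "rat fps fps \<Rightarrow> bool" where
  "int_coeffs F \<longleftrightarrow> (\<forall>n r. fps_nth (fps_nth F n) r \<in> \<int>)"

lemma int_coeffs_1: "int_coeffs 1"
  by (simp add: int_coeffs_def fps_one_nth)

lemma int_coeffs_mult: "int_coeffs F \<Longrightarrow> int_coeffs G \<Longrightarrow> int_coeffs (F * G)"
  by (auto simp: int_coeffs_def fps_mult_nth fps_sum_nth intro!: Ints_sum Ints_mult)

lemma int_coeffs_power: "int_coeffs F \<Longrightarrow> int_coeffs (F ^ n)"
  by (induction n) (auto intro: int_coeffs_1 int_coeffs_mult)

lemma int_coeffs_prod: "(\<And>x. x \<in> S \<Longrightarrow> int_coeffs (F x)) \<Longrightarrow> int_coeffs (\<Prod>x\<in>S. F x)"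
  by (induction S rule: infinite_finite_induct) (auto intro: int_coeffs_1 int_coeffs_mult)

lemma int_coeffs_yz_factor_powi:
  assumes "j \<ge> 1"
  shows "int_coeffs (yz_factor k j powi n)"
proof -
  have "int_coeffs (yz_factor k j)" "int_coeffs (inverse (yz_factor k j))"
    using assms by (auto simp: int_coeffs_def yz_factor_nth inverse_yz_factor fps_one_nth fps_X_power_nth)
  then show ?thesis by (simp add: power_int_def int_coeffs_power)
qed

text \<open>The series z d/dz log(1 - z^j y^k) = - j * (sum over m >= 1 of z^(j m) y^(k m)); the
  condition n > 0 excludes m = 0.\<close>

definition yz_log_deriv :: "nat \<Rightarrow> nat \<Rightarrow> rat fps fps" where
  "yz_log_deriv k j = Abs_fps (\<lambda>n. Abs_fps (\<lambda>r. if n > 0 \<and> (\<exists>m. n = j * m \<and> r = k * m) then - of_nat j else 0))"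

text \<open>Multiplication by 1 - z^j y^k shifts exponents by (j, k), that is, m to m + 1. All terms
  with m >= 2 cancel, and the remaining term - j z^j y^k is z times the derivative of the
  factor.\<close>

lemma fps_log_deriv_yz_factor:
  assumes j: "j \<ge> 1" and k: "k \<ge> 1"
  shows "fps_log_deriv (yz_factor k j) (yz_log_deriv k j)"
  unfolding fps_log_deriv_def
proof (intro fps_ext)
  fix n r
  define p where "p = (\<lambda>n r. n > 0 \<and> (\<exists>m. n = j * m \<and> r = k * m))"
  have E: "fps_nth (fps_nth (yz_log_deriv k j) n) r = (if p n r then - of_nat j else 0)" for n r
    by (simp add: yz_log_deriv_def p_def)
  \<comment> \<open>The region where no shifted term can cancel: there only m = 1 is
    possible.\<close>
  have p_low: "p n r \<longleftrightarrow> n = j \<and> r = k" if "n \<le> j \<or> r < k" for n r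
  proof
    assume "p n r"
    then obtain m where m: "n > 0" "n = j * m" "r = k * m" by (auto simp: p_def)
    then obtain m' where "m = Suc m'" by (cases m) auto
    then have "m = 1" using m that j k by (cases m') auto
    then show "n = j \<and> r = k" using m by simp
  next
    assume "n = j \<and> r = k"
    then show "p n r" using j unfolding p_def by (intro conjI exI[of _ 1]) auto
  qed
  have p_shift: "p (n - j) (r - k) \<longleftrightarrow> p n r" if "n > j" "r \<ge> k" for n r
  proof
    assume "p (n - j) (r - k)"
    then obtain m where "n - j = j * m" "r - k = k * m" by (auto simp: p_def)
    then have "n = j * Suc m" "r = k * Suc m" using that by (simp_all only: mult_Suc_right)
    then show "p n r" using that unfolding p_def by (intro conjI exI[of _ "Suc m"]) auto
  next
    assume "p n r"
    then obtain m where "n = j * m" "r = k * m" by (auto simp: p_def)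
    then have "n - j = j * (m - 1)" "r - k = k * (m - 1)" by (simp_all add: diff_mult_distrib2)
    moreover have "n - j > 0" using that by simp
    ultimately show "p (n - j) (r - k)" unfolding p_def by blast
  qed
  have "fps_nth (fps_nth (yz_factor k j * yz_log_deriv k j) n) r =
      fps_nth (fps_nth (yz_log_deriv k j) n) r -
      (if n < j \<or> r < k then 0 else fps_nth (fps_nth (yz_log_deriv k j) (n - j)) (r - k))"
    by (simp add: yz_factor_def left_diff_distrib fps_nth_const_mult_X_power fps_X_power_mult_nth)
  also have "\<dots> = (if n = j \<and> r = k then - of_nat j else 0)"
  proof (cases "n > j \<and> r \<ge> k")
    case True
    then show ?thesis using p_shift[of n r] by (simp add: E)
  next
    case False
    then have "p n r \<longleftrightarrow> n = j \<and> r = k" by (intro p_low) linarith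
    moreover have "\<not> p (n - j) (r - k)" if "\<not> (n < j \<or> r < k)"
      using False that by (auto simp: p_def)
    ultimately show ?thesis by (simp add: E)
  qed
  also have "\<dots> = fps_nth (fps_nth (fps_X * fps_deriv (yz_factor k j)) n) r"
  proof (cases n)
    case 0
    then show ?thesis using j by simp
  next
    case (Suc n')
    have "fps_nth (fps_X * fps_deriv (yz_factor k j)) n = of_nat n * fps_nth (yz_factor k j) n"
      unfolding Suc by (simp del: of_nat_Suc)
    then have "fps_nth (fps_nth (fps_X * fps_deriv (yz_factor k j)) n) r =
        fps_nth (of_nat n * fps_nth (yz_factor k j) n) r" by (simp only:)
    also have "\<dots> = (if n = j \<and> r = k then - of_nat j else 0)"
      using j Suc unfolding fps_mult_of_nat_nth by (simp add: yz_factor_nth)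
    finally show ?thesis by (rule sym)
  qed
  finally show "fps_nth (fps_nth (fps_X * fps_deriv (yz_factor k j)) n) r =
      fps_nth (fps_nth (yz_factor k j * yz_log_deriv k j) n) r" by (rule sym)
qed

text \<open>The series z d/dz log(1 - y f) = - (sum over r >= 1 of y^r z (f^r)' / r). Its entry at r
  = 0 is 0, as it should be, by the convention x / 0 = 0.\<close>

definition one_minus_yf_log_deriv :: "(nat \<Rightarrow> int) \<Rightarrow> rat fps fps" where
  "one_minus_yf_log_deriv a = Abs_fps (\<lambda>n. Abs_fps (\<lambda>r. - of_nat n * of_int (pcoef a r n) / of_nat r))"

lemma one_minus_yf_log_deriv_nth:
  "fps_nth (fps_nth (one_minus_yf_log_deriv a) n) r = - (of_nat n * of_int (pcoef a r n) / of_nat r)"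
  unfolding one_minus_yf_log_deriv_def fps_nth_Abs_fps mult_minus_left minus_divide_left by (rule refl)

text \<open>Both sides are coefficients of z f' times a power of f, since z (f^s)' / s = z f'
  f^(s-1); multiplying by f raises s by one.\<close>

lemma pcoef_deriv:
  assumes "s \<ge> 1"
  shows "(\<Sum>i=0..n. of_int (a i) * (of_nat (n - i) * of_int (pcoef a s (n - i)) / of_nat s))
    = (of_nat n * of_int (pcoef a (Suc s) n) / of_nat (Suc s) :: rat)"
proof -
  define F :: "rat fps" where "F = Abs_fps (\<lambda>j. of_int (a j))"
  have c: "of_int (pcoef a s n) = fps_nth (F ^ s) n" for s n
    by (simp add: F_def fps_nth_power_of_int)
  have d: "of_nat n * of_int (pcoef a s n) / of_nat s = fps_nth (fps_X * fps_deriv F * F ^ (s - 1)) n"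
    if "s \<ge> 1" for s n
  proof -
    have "of_nat n * of_int (pcoef a s n) = fps_nth (fps_X * fps_deriv (F ^ s)) n"
      by (cases n) (auto simp: c)
    also have "fps_X * fps_deriv (F ^ s) = fps_const (of_nat s) * (fps_X * fps_deriv F * F ^ (s - 1))"
      by (simp add: fps_deriv_power mult_ac)
    also have "fps_nth \<dots> n = of_nat s * fps_nth (fps_X * fps_deriv F * F ^ (s - 1)) n"
      by (rule fps_mult_left_const_nth)
    finally show ?thesis using that by simp
  qed
  have "(\<Sum>i=0..n. of_int (a i) * (of_nat (n - i) * of_int (pcoef a s (n - i)) / of_nat s))
    = fps_nth (F * (fps_X * fps_deriv F * F ^ (s - 1))) n"
    unfolding fps_mult_nth[of F] d[OF assms] by (simp add: F_def)
  also have "F * (fps_X * fps_deriv F * F ^ (s - 1)) = fps_X * fps_deriv F * F ^ (Suc s - 1)"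
    using assms by (cases s) (simp_all add: mult_ac)
  finally show ?thesis using d[of "Suc s" n] by simp
qed

text \<open>Multiplication by y f moves the coefficient of y^s to y^(s+1), where
  \<open>pcoef_deriv\<close> shows that it equals the one already there. Everything cancels except -
  z f' at y^1.\<close>

lemma fps_log_deriv_one_minus_yf: "fps_log_deriv (one_minus_yf a) (one_minus_yf_log_deriv a)"
  unfolding fps_log_deriv_def
proof (intro fps_ext)
  fix n r
  let ?\<Phi> = "Abs_fps (\<lambda>j. fps_const (of_int (a j)) * fps_X) :: rat fps fps"
  have conv: "fps_nth (fps_nth (?\<Phi> * one_minus_yf_log_deriv a) n) r =
     (if r = 0 then 0 else (\<Sum>i=0..n. of_int (a i) * fps_nth (fps_nth (one_minus_yf_log_deriv a) (n - i)) (r - 1)))"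
    by (auto simp: fps_mult_nth[of ?\<Phi>] fps_sum_nth mult.assoc)
  have lhs: "fps_nth (fps_nth (fps_X * fps_deriv (one_minus_yf a)) n) r =
      (if r = 1 then - of_nat n * of_int (a n) else 0)"
  proof (cases n)
    case (Suc n')
    have "fps_nth (fps_X * fps_deriv (one_minus_yf a)) n = of_nat n * (- (fps_const (of_int (a n)) * fps_X))"
      unfolding Suc by (simp add: one_minus_yf_def del: of_nat_Suc)
    then have "fps_nth (fps_nth (fps_X * fps_deriv (one_minus_yf a)) n) r =
        fps_nth (of_nat n * (- (fps_const (of_int (a n)) * fps_X))) r" by (simp only:)
    then show ?thesis unfolding fps_mult_of_nat_nth by (simp only: fps_neg_nth fps_mult_left_const_nth fps_X_nth) simp
  qed simp
  have rhs: "fps_nth (fps_nth (one_minus_yf a * one_minus_yf_log_deriv a) n) r =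
     fps_nth (fps_nth (one_minus_yf_log_deriv a) n) r - fps_nth (fps_nth (?\<Phi> * one_minus_yf_log_deriv a) n) r"
    by (simp add: one_minus_yf_def left_diff_distrib)
  consider "r = 0" | "r = 1" | s where "r = Suc s" "s \<ge> 1" by (cases r) (auto simp: Suc_le_eq)
  then have "fps_nth (fps_nth (one_minus_yf_log_deriv a) n) r - fps_nth (fps_nth (?\<Phi> * one_minus_yf_log_deriv a) n) r
      = (if r = 1 then - of_nat n * of_int (a n) else 0)"
  proof cases
    case 1
    then show ?thesis unfolding conv by (simp add: one_minus_yf_log_deriv_def)
  next
    case 2
    then show ?thesis unfolding conv by (simp add: one_minus_yf_log_deriv_def pcoef_1)
  next
    case 3
    have "(\<Sum>i=0..n. of_int (a i) * fps_nth (fps_nth (one_minus_yf_log_deriv a) (n - i)) s)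
        = - (\<Sum>i=0..n. of_int (a i) * (of_nat (n - i) * of_int (pcoef a s (n - i)) / of_nat s))"
      unfolding sum_negf[symmetric] by (intro sum.cong) (simp_all add: one_minus_yf_log_deriv_def)
    also have "\<dots> = fps_nth (fps_nth (one_minus_yf_log_deriv a) n) (Suc s)"
      unfolding pcoef_deriv[OF 3(2)] by (simp add: one_minus_yf_log_deriv_def)
    finally have "fps_nth (fps_nth (?\<Phi> * one_minus_yf_log_deriv a) n) r = fps_nth (fps_nth (one_minus_yf_log_deriv a) n) r"
      unfolding conv by (simp only: 3(1) diff_Suc_1 nat.distinct if_False)
    moreover have "r \<noteq> 1" using 3 by simp
    ultimately show ?thesis by (simp only: diff_self if_False)
  qed
  then show "fps_nth (fps_nth (fps_X * fps_deriv (one_minus_yf a)) n) r =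
      fps_nth (fps_nth (one_minus_yf a * one_minus_yf_log_deriv a) n) r"
    unfolding lhs rhs by (rule sym)
qed

section \<open>Truncated products and the induction on N\<close>

lemma j0_pos:
  assumes "a 0 = 0" "\<exists>j. a j \<noteq> 0"
  shows "j0 a \<ge> 1"
proof -
  have "a (j0 a) \<noteq> 0" unfolding j0_def using assms(2) by (rule LeastI_ex)
  then show ?thesis using assms(1) by (cases "j0 a") auto
qed

text \<open>Modulo z^N only these factors differ from 1. For j0 >= 1 there are finitely many of
  them, because k <= j.\<close>

definition kj_set :: "(nat \<Rightarrow> int) \<Rightarrow> nat \<Rightarrow> (nat \<times> nat) set" where
  "kj_set a N = {(k, j). 1 \<le> k \<and> k * j0 a \<le> j \<and> j < N}"

lemma kj_setD:
  assumes "j0 a \<ge> 1" "(k, j) \<in> kj_set a N"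
  shows "1 \<le> k" "1 \<le> j" "k \<le> j" "k * j0 a \<le> j" "j < N"
proof -
  have "k * 1 \<le> k * j0 a" using assms(1) by (intro mult_left_mono) auto
  moreover have "1 \<le> k" "k * j0 a \<le> j" "j < N" using assms(2) by (auto simp: kj_set_def)
  ultimately show "1 \<le> k" "1 \<le> j" "k \<le> j" "k * j0 a \<le> j" "j < N" by linarith+
qed

lemma finite_kj_set:
  assumes "j0 a \<ge> 1"
  shows "finite (kj_set a N)"
proof (rule finite_subset)
  show "kj_set a N \<subseteq> {..N} \<times> {..N}"
    using kj_setD[OF assms] by fastforce
qed simp

text \<open>A factor (k, j) meets z^n y^r only if (n, r) = (j m, k m), so the pairs correspond to
  common divisors m of n and r with weight j h(j,k) = (n/m) h(n/m, r/m). The constraint k j0 <= j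
  disappears because h vanishes outside it. The hypothesis \<open>int\<close> identifies the floors
  with the coefficients themselves.\<close>

lemma sum_kj_set_log_deriv:
  assumes j0: "j0 a \<ge> 1" and n: "n \<ge> 1" and r: "r \<ge> 1"
    and int: "\<And>j k. j < N \<Longrightarrow> k \<ge> 1 \<Longrightarrow> h_coeff a j k \<in> \<int>"
  shows "(\<Sum>(k,j)\<in>kj_set a N. of_int (- h_int a j k) * fps_nth (fps_nth (yz_log_deriv k j) n) r)
    = of_nat n * (\<Sum>m | m dvd r \<and> m dvd n \<and> n div m < N. h_coeff a (n div m) (r div m) / of_nat m)"
proof -
  have h: "of_int (h_int a j k) = h_coeff a j k" if "j < N" "k \<ge> 1" for j k
    unfolding h_int_def using int[OF that] by (auto elim!: Ints_cases)
  then have hk: "of_int (h_int a j k) = h_coeff a j k" if "(k, j) \<in> kj_set a N" for k j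
    using kj_setD(1,5)[OF j0 that] by blast
  let ?S = "{(k,j) \<in> kj_set a N. \<exists>m. n = j * m \<and> r = k * m}"
  have "(\<Sum>(k,j)\<in>kj_set a N. of_int (- h_int a j k) * fps_nth (fps_nth (yz_log_deriv k j) n) r)
      = (\<Sum>(k,j)\<in>?S. of_nat j * h_coeff a j k)"
    using n by (intro sum.mono_neutral_cong_right finite_kj_set j0)
      (auto simp: yz_log_deriv_def hk split: if_splits)
  also have "\<dots> = (\<Sum>m | m dvd r \<and> m dvd n \<and> n div m < N \<and> (r div m) * j0 a \<le> n div m.
      of_nat (n div m) * h_coeff a (n div m) (r div m))"
  proof (intro sum.reindex_bij_witness[of _ "\<lambda>m. (r div m, n div m)" "\<lambda>(k,j). n div j"])
    fix x assume "x \<in> ?S"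
    then obtain k j m where x: "x = (k, j)" "(k, j) \<in> kj_set a N" "n = j * m" "r = k * m" by auto
    note kj = kj_setD[OF j0 x(2)]
    have m: "m > 0" using n x by (cases m) auto
    have "n div j = m" "n div m = j" "r div m = k" using kj m by (auto simp: x)
    then show "(\<lambda>m. (r div m, n div m)) (case x of (k,j) \<Rightarrow> n div j) = x"
      "(case x of (k,j) \<Rightarrow> n div j) \<in> {m. m dvd r \<and> m dvd n \<and> n div m < N \<and> (r div m) * j0 a \<le> n div m}"
      "of_nat (n div (case x of (k,j) \<Rightarrow> n div j)) *
         h_coeff a (n div (case x of (k,j) \<Rightarrow> n div j)) (r div (case x of (k,j) \<Rightarrow> n div j)) =
       (case x of (k,j) \<Rightarrow> of_nat j * h_coeff a j k)"
      using kj by (auto simp: x)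
  next
    fix m assume "m \<in> {m. m dvd r \<and> m dvd n \<and> n div m < N \<and> (r div m) * j0 a \<le> n div m}"
    then have m: "m dvd r" "m dvd n" "n div m < N" "(r div m) * j0 a \<le> n div m" by auto
    then have pos: "m > 0" "r div m > 0" "n div m > 0" using n r by (auto elim!: dvdE)
    show "(case (r div m, n div m) of (k,j) \<Rightarrow> n div j) = m"
      using m(2) pos n by (auto elim!: dvdE)
    show "(r div m, n div m) \<in> ?S"
      using m pos by (auto simp: kj_set_def intro!: exI[of _ m])
  qed
  also have "\<dots> = (\<Sum>m | m dvd r \<and> m dvd n \<and> n div m < N. of_nat (n div m) * h_coeff a (n div m) (r div m))"
  proof (intro sum.mono_neutral_left)
    show "finite {m. m dvd r \<and> m dvd n \<and> n div m < N}"
      using r by (intro finite_subset[OF _ finite_divisors_nat[of r]]) auto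
    show "\<forall>m\<in>{m. m dvd r \<and> m dvd n \<and> n div m < N} - {m. m dvd r \<and> m dvd n \<and> n div m < N \<and> (r div m) * j0 a \<le> n div m}.
        of_nat (n div m) * h_coeff a (n div m) (r div m) = 0"
    proof
      fix m assume m: "m \<in> {m. m dvd r \<and> m dvd n \<and> n div m < N} - {m. m dvd r \<and> m dvd n \<and> n div m < N \<and> (r div m) * j0 a \<le> n div m}"
      then have "r div m \<ge> 1" using r by (auto elim!: dvdE)
      moreover have "n div m < (r div m) * j0 a" using m by auto
      ultimately show "of_nat (n div m) * h_coeff a (n div m) (r div m) = 0"
        using h_coeff_eq_0 by simp
    qed
  qed auto
  also have "\<dots> = of_nat n * (\<Sum>m | m dvd r \<and> m dvd n \<and> n div m < N. h_coeff a (n div m) (r div m) / of_nat m)"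
    unfolding sum_distrib_left using n by (intro sum.cong) (auto elim!: dvdE)
  finally show ?thesis .
qed

text \<open>For V = (1 - y f) W, with W inverse to the truncated product, the logarithmic derivative
  at z^n y^r is n times a truncated divisor sum minus n times the full one of
  \<open>sum_h_coeff_divisors\<close>. Hence V is 1 modulo z^N and its coefficient at z^N y^k is -
  h(N,k). That number is an integer because 1 - y f and W both lie in Z[[y]][[z]].\<close>

lemma formal_product_step:
  assumes a0: "a 0 = 0" and j0: "j0 a \<ge> 1" and N: "N \<ge> 1"
    and int: "\<And>j k. j < N \<Longrightarrow> k \<ge> 1 \<Longrightarrow> h_coeff a j k \<in> \<int>"
  shows "\<And>n. n < N \<Longrightarrow> fps_nth (one_minus_yf a) n = fps_nth (\<Prod>(k,j)\<in>kj_set a N. formal_factor a k j) n"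
    and "\<And>k. k \<ge> 1 \<Longrightarrow> h_coeff a N k \<in> \<int>"
proof -
  define G where "G = (\<Prod>(k,j)\<in>kj_set a N. formal_factor a k j)"
  define W where "W = (\<Prod>(k,j)\<in>kj_set a N. yz_factor k j powi (- h_int a j k))"
  define V where "V = one_minus_yf a * W"
  define E where "E = one_minus_yf_log_deriv a + (\<Sum>(k,j)\<in>kj_set a N. of_int (- h_int a j k) * yz_log_deriv k j)"
  note kj = kj_setD[OF j0]
  have unit: "fps_nth F 0 = 1" if "\<And>x. x \<in> S \<Longrightarrow> fps_nth (f x) 0 = 1" "F = (\<Prod>x\<in>S. f x)" for F and f :: "nat \<times> nat \<Rightarrow> rat fps fps" and S
    using that(1) unfolding that(2) by (induction S rule: infinite_finite_induct) auto
  have GW: "G * W = 1"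
    unfolding G_def W_def prod.distrib[symmetric]
    by (intro prod.neutral) (auto simp: formal_factor_eq intro!: fps_powi_mult_powi_minus inverse_yz_factor(1) dest: kj(2))
  have W0: "fps_nth W 0 = 1"
    by (rule unit[OF _ W_def]) (auto simp: fps_nth_yz_factor_powi dest: kj(2))
  have "fps_log_deriv W (\<Sum>x\<in>kj_set a N. case x of (k,j) \<Rightarrow> of_int (- h_int a j k) * yz_log_deriv k j)"
    unfolding W_def by (rule fps_log_deriv_prod)
      (auto intro!: fps_log_deriv_powi fps_log_deriv_yz_factor inverse_yz_factor(1) simp del: of_int_minus dest: kj(1,2))
  then have V: "fps_log_deriv V E"
    unfolding V_def E_def by (intro fps_log_deriv_mult fps_log_deriv_one_minus_yf)
  have V0: "fps_nth V 0 = 1" by (simp add: V_def W0 one_minus_yf_def a0)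
  have Ecoef: "fps_nth (fps_nth E n) r = fps_nth (fps_nth (one_minus_yf_log_deriv a) n) r +
      (\<Sum>(k,j)\<in>kj_set a N. of_int (- h_int a j k) * fps_nth (fps_nth (yz_log_deriv k j) n) r)" for n r
    by (simp add: E_def fps_sum_nth case_prod_unfold flip: fps_of_int)
  have E_low: "fps_nth (fps_nth E n) r = 0" if "n = 0 \<or> r = 0" for n r
  proof -
    have "fps_nth (fps_nth (yz_log_deriv k j) n) r = 0" if "(k, j) \<in> kj_set a N" for k j
      using \<open>n = 0 \<or> r = 0\<close> kj[OF that] by (auto simp: yz_log_deriv_def)
    then show ?thesis using that unfolding Ecoef
      by (auto simp: one_minus_yf_log_deriv_def intro!: sum.neutral)
  qed
  have E_eq: "fps_nth (fps_nth E n) r = (if n < N then 0 else - of_nat n * h_coeff a n r)"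
    if "n \<ge> 1" "r \<ge> 1" "n \<le> N" for n r
  proof -
    let ?D = "{m. m dvd r \<and> m dvd n}" and ?t = "\<lambda>m. h_coeff a (n div m) (r div m) / of_nat m"
    have fin: "finite ?D" using that by (intro finite_subset[OF _ finite_divisors_nat[of r]]) auto
    \<comment> \<open>The truncation removes nothing for n < N. For n = N it removes exactly the
      divisor m = 1, whose term is h(N, r).\<close>
    have div: "n div m < N \<longleftrightarrow> n < N \<or> m \<noteq> 1" if "m \<in> ?D" for m
    proof (cases "m = 1")
      case False
      then have "m > 1" using that \<open>n \<ge> 1\<close> by (cases m) auto
      then have "n div m < n" using \<open>n \<ge> 1\<close> by (intro div_less_dividend) auto
      then show ?thesis using \<open>n \<le> N\<close> False by auto
    qed auto
    have "(\<Sum>(k,j)\<in>kj_set a N. of_int (- h_int a j k) * fps_nth (fps_nth (yz_log_deriv k j) n) r) =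
        of_nat n * (\<Sum>m | m dvd r \<and> m dvd n \<and> n div m < N. ?t m)"
      by (rule sum_kj_set_log_deriv[OF j0 that(1,2) int])
    moreover have "fps_nth (fps_nth (one_minus_yf_log_deriv a) n) r = - (of_nat n * (\<Sum>m\<in>?D. ?t m))"
      by (simp only: one_minus_yf_log_deriv_nth sum_h_coeff_divisors[OF that(2)] times_divide_eq_right)
    ultimately have "fps_nth (fps_nth E n) r = of_nat n * ((\<Sum>m | m dvd r \<and> m dvd n \<and> n div m < N. ?t m) - (\<Sum>m\<in>?D. ?t m))"
      by (simp only: Ecoef right_diff_distrib)
    also have "(\<Sum>m | m dvd r \<and> m dvd n \<and> n div m < N. ?t m) - (\<Sum>m\<in>?D. ?t m) =
        - (\<Sum>m\<in>?D - {m. m dvd r \<and> m dvd n \<and> n div m < N}. ?t m)"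
      by (subst sum_diff[OF fin]) auto
    also have "?D - {m. m dvd r \<and> m dvd n \<and> n div m < N} = (if n < N then {} else {1})"
      using div by auto
    finally show ?thesis by auto
  qed
  have E0: "fps_nth E n = 0" if "n < N" for n
  proof (rule fps_ext)
    fix r show "fps_nth (fps_nth E n) r = fps_nth 0 r"
      using E_low[of n r] E_eq[of n r] that by (cases "n = 0 \<or> r = 0") auto
  qed
  note Vn = fps_log_deriv_imp_nth[OF V V0 E0 N]
  show "fps_nth (one_minus_yf a) n = fps_nth (\<Prod>(k,j)\<in>kj_set a N. formal_factor a k j) n" if "n < N" for n
  proof -
    have "one_minus_yf a = V * G" using GW by (simp add: V_def mult.assoc mult.commute)
    then have "fps_nth (one_minus_yf a) n = (\<Sum>i=0..n. fps_nth V i * fps_nth G (n - i))"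
      by (simp add: fps_mult_nth)
    also have "\<dots> = (\<Sum>i\<in>{0}. fps_nth V i * fps_nth G (n - i))"
      using Vn(1) that by (intro sum.mono_neutral_right) auto
    finally show ?thesis by (simp add: V0 G_def)
  qed
  show "h_coeff a N k \<in> \<int>" if "k \<ge> 1" for k
  proof -
    have "int_coeffs (one_minus_yf a)"
      by (auto simp: int_coeffs_def one_minus_yf_def fps_one_nth fps_X_def)
    moreover have "int_coeffs W"
      unfolding W_def by (rule int_coeffs_prod) (auto intro!: int_coeffs_yz_factor_powi dest: kj(2))
    ultimately have "fps_nth (fps_nth V N) k \<in> \<int>"
      using int_coeffs_mult unfolding V_def int_coeffs_def by blast
    moreover have "fps_nth (of_nat N * fps_nth V N) k = of_nat N * fps_nth (fps_nth V N) k"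
      by (simp flip: fps_of_nat)
    then have "of_nat N * (fps_nth (fps_nth V N) k + h_coeff a N k) = 0"
      using Vn(2) E_eq[of N k] N that by (simp add: distrib_left)
    then have "fps_nth (fps_nth V N) k + h_coeff a N k = 0" using N by simp
    then have "fps_nth (fps_nth V N) k = - h_coeff a N k" by (simp only: eq_neg_iff_add_eq_0)
    ultimately show ?thesis by simp
  qed
qed

theorem h_coeff_Ints:
  assumes "a 0 = 0" "j0 a \<ge> 1" "k \<ge> 1"
  shows "h_coeff a j k \<in> \<int>"
  using assms(3)
proof (induction j arbitrary: k rule: less_induct)
  case (less j)
  show ?case
  proof (cases "j = 0")
    case True
    \<comment> \<open>The inductive step starts at N = 1; degree 0 is covered by the support bound,
      since 0 < k j0.\<close>
    have "h_coeff a 0 k = 0" using assms less by (intro h_coeff_eq_0) auto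
    then show ?thesis by (simp add: True)
  next
    case False
    show ?thesis
    proof (rule formal_product_step(2)[OF assms(1,2) _ _ less.prems])
      show "1 \<le> j" using False by simp
    qed (rule less.IH)
  qed
qed

lemma of_int_h_int:
  assumes "a 0 = 0" "j0 a \<ge> 1" "k \<ge> 1"
  shows "of_int (h_int a j k) = h_coeff a j k"
  unfolding h_int_def using h_coeff_Ints[OF assms, of j] by (auto elim!: Ints_cases)

section \<open>Congruence modulo z^N and z-adic convergence\<close>

definition fps_cong :: "nat \<Rightarrow> 'b::comm_ring_1 fps \<Rightarrow> 'b fps \<Rightarrow> bool" where
  "fps_cong N F G \<longleftrightarrow> (\<forall>n<N. fps_nth F n = fps_nth G n)"

lemma fps_cong_refl: "fps_cong N F F"
  by (simp add: fps_cong_def)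

lemma fps_cong_trans: "fps_cong N F G \<Longrightarrow> fps_cong N G H \<Longrightarrow> fps_cong N F H"
  by (simp add: fps_cong_def)

lemma fps_cong_mult: "fps_cong N F G \<Longrightarrow> fps_cong N F' G' \<Longrightarrow> fps_cong N (F * F') (G * G')"
  by (auto simp: fps_cong_def fps_mult_nth intro!: sum.cong)

lemma fps_cong_prod: "(\<And>x. x \<in> S \<Longrightarrow> fps_cong N (F x) (G x)) \<Longrightarrow> fps_cong N (\<Prod>x\<in>S. F x) (\<Prod>x\<in>S. G x)"
  by (induction S rule: infinite_finite_induct) (auto simp: fps_cong_refl fps_cong_mult)

lemma fps_cong_prod_mono:
  assumes "finite T" "S \<subseteq> T" "\<And>x. x \<in> T - S \<Longrightarrow> fps_cong N (F x) 1"
  shows "fps_cong N (\<Prod>x\<in>T. F x) (\<Prod>x\<in>S. F x)"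
proof -
  have "fps_cong N (\<Prod>x\<in>T-S. F x) 1"
    using fps_cong_prod[of "T - S" N F "\<lambda>_. 1"] assms(3) by simp
  then have "fps_cong N ((\<Prod>x\<in>T-S. F x) * (\<Prod>x\<in>S. F x)) (1 * (\<Prod>x\<in>S. F x))"
    by (rule fps_cong_mult) (rule fps_cong_refl)
  then show ?thesis unfolding prod.subset_diff[OF assms(2,1), of F] by simp
qed

text \<open>Convergence of formal power series means that each coefficient is eventually constant.
  The nonzero limit lets \<open>has_prod\<close> hold with no initial factors split off.\<close>

lemma fps_has_prodI:
  fixes F :: "nat \<Rightarrow> 'b::comm_ring_1 fps"
  assumes "P \<noteq> 0" "\<And>n M. M \<ge> n \<Longrightarrow> fps_nth (\<Prod>i\<le>M. F i) n = fps_nth P n"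
  shows "F has_prod P"
proof -
  have "(\<lambda>M. \<Prod>i\<le>M. F i) \<longlonglongrightarrow> P"
    using assms(2) by (intro tendsto_fpsI) (auto simp: eventually_sequentially)
  then show ?thesis using assms(1) by (simp add: has_prod_def raw_has_prod_def)
qed

theorem formal_product_identity:
  assumes a0: "a 0 = 0" and j0: "j0 a \<ge> 1"
  shows "\<exists>P :: nat \<Rightarrow> rat fps fps.
    (\<forall>k\<ge>1. (\<lambda>i. formal_factor a k (i + k * j0 a)) has_prod P k) \<and>
    (\<lambda>i. P (i + 1)) has_prod one_minus_yf a"
proof -
  define ff where "ff = formal_factor a"
  \<comment> \<open>A diagonal choice: the coefficient of z^n is read off the product over i <= n.
    Later factors have j = i + k j0 > n and are 1 modulo z^(n+1).\<close>
  define P where "P = (\<lambda>k. Abs_fps (\<lambda>n. fps_nth (\<Prod>i\<le>n. ff k (i + k * j0 a)) n))"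
  have ff_1: "fps_cong N (ff k j) 1" if "j \<ge> N" "j \<ge> 1" for N k j
    using that by (auto simp: fps_cong_def ff_def formal_factor_eq fps_nth_yz_factor_powi)
  have pos: "k * j0 a \<ge> 1" if "k \<ge> 1" for k using that j0 by (simp add: Suc_le_eq)
  have P: "fps_nth (\<Prod>i\<le>M. ff k (i + k * j0 a)) n = fps_nth (P k) n" if "n \<le> M" "k \<ge> 1" for M n k
  proof -
    have "fps_cong (Suc n) (\<Prod>i\<le>M. ff k (i + k * j0 a)) (\<Prod>i\<le>n. ff k (i + k * j0 a))"
      using that pos[OF that(2)] by (intro fps_cong_prod_mono ff_1) auto
    then show ?thesis by (simp add: fps_cong_def P_def)
  qed
  have prod_P: "(\<lambda>i. ff k (i + k * j0 a)) has_prod P k" if "k \<ge> 1" for k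
  proof (rule fps_has_prodI)
    have "fps_nth (P k) 0 = 1"
      using pos[OF that] by (simp add: P_def ff_def formal_factor_eq fps_nth_yz_factor_powi)
    then show "P k \<noteq> 0" by auto
  qed (rule P[OF _ that])
  have "(\<lambda>i. P (i + 1)) has_prod one_minus_yf a"
  proof (rule fps_has_prodI)
    have "fps_nth (one_minus_yf a) 0 = 1" by (simp add: one_minus_yf_def a0)
    then show "one_minus_yf a \<noteq> 0" by auto
  next
    fix n M :: nat assume M: "M \<ge> n"
    \<comment> \<open>The rectangle is mapped by the index shift onto pairs (k, j) that include all
      those with j <= n, because k <= j <= n <= M. The surplus pairs have j > n and contribute 1
      modulo z^(n+1).\<close>
    define T where "T = (SIGMA i:{..M}. {..n})"
    define \<phi> where "\<phi> = (\<lambda>(i::nat, i'). (i + 1, i' + (i + 1) * j0 a))"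
    have inj: "inj_on \<phi> T" by (auto simp: inj_on_def \<phi>_def)
    have "fps_cong (Suc n) (\<Prod>i\<le>M. P (i + 1)) (\<Prod>i\<le>M. \<Prod>i'\<le>n. ff (i + 1) (i' + (i + 1) * j0 a))"
    proof (intro fps_cong_prod)
      fix i
      show "fps_cong (Suc n) (P (i + 1)) (\<Prod>i'\<le>n. ff (i + 1) (i' + (i + 1) * j0 a))"
        unfolding fps_cong_def by (intro allI impI, rule P[symmetric]) auto
    qed
    also have "(\<Prod>i\<le>M. \<Prod>i'\<le>n. ff (i + 1) (i' + (i + 1) * j0 a)) = (\<Prod>x\<in>T. case \<phi> x of (k, j) \<Rightarrow> ff k j)"
      unfolding T_def \<phi>_def by (subst prod.Sigma) (auto simp: case_prod_unfold)
    also have "\<dots> = (\<Prod>(k,j)\<in>\<phi> ` T. ff k j)"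
      by (simp add: prod.reindex[OF inj])
    finally have 1: "fps_cong (Suc n) (\<Prod>i\<le>M. P (i + 1)) (\<Prod>(k,j)\<in>\<phi> ` T. ff k j)" .
    have 2: "fps_cong (Suc n) (\<Prod>(k,j)\<in>\<phi> ` T. ff k j) (\<Prod>(k,j)\<in>kj_set a (Suc n). ff k j)"
    proof (rule fps_cong_prod_mono)
      show "kj_set a (Suc n) \<subseteq> \<phi> ` T"
      proof
        fix x assume x: "x \<in> kj_set a (Suc n)"
        obtain k j where [simp]: "x = (k, j)" by force
        note kj = kj_setD[OF j0, of k j "Suc n"]
        have "x = \<phi> (k - 1, j - k * j0 a)" "(k - 1, j - k * j0 a) \<in> T"
          using x kj M by (cases k; auto simp: \<phi>_def T_def)+
        then show "x \<in> \<phi> ` T" by blast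
      qed
      fix x assume x: "x \<in> \<phi> ` T - kj_set a (Suc n)"
      then obtain k j where kj: "x = (k, j)" "k \<ge> 1" "k * j0 a \<le> j" by (auto simp: \<phi>_def)
      then have "j \<ge> Suc n" "j \<ge> 1" using x pos[of k] by (auto simp: kj_set_def)
      then show "fps_cong (Suc n) (case x of (k, j) \<Rightarrow> ff k j) 1" by (simp add: kj ff_1)
    qed (simp add: T_def)
    have 3: "fps_cong (Suc n) (\<Prod>(k,j)\<in>kj_set a (Suc n). ff k j) (one_minus_yf a)"
      unfolding ff_def fps_cong_def
      by (intro allI impI, rule formal_product_step(1)[OF a0 j0, symmetric]) (auto intro: h_coeff_Ints[OF a0 j0])
    show "fps_nth (\<Prod>i\<le>M. P (i + 1)) n = fps_nth (one_minus_yf a) n"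
      using fps_cong_trans[OF fps_cong_trans[OF 1 2] 3] by (simp add: fps_cong_def)
  qed
  then show ?thesis using prod_P unfolding ff_def by blast
qed

section \<open>The logarithm of the analytic product\<close>

lemma has_sum_pcoef_abs:
  assumes x: "0 \<le> x" "ereal x < rho_c a"
  shows "((\<lambda>j. of_int (pcoef (\<lambda>j. \<bar>a j\<bar>) k j) * x ^ j) has_sum g_fun a x ^ k) UNIV"
proof -
  define F :: "real fps" where "F = Abs_fps (\<lambda>j. of_int \<bar>a j\<bar>)"
  have rad: "ereal (norm x) < fps_conv_radius F"
    using x by (simp add: F_def fps_conv_radius_def rho_c_def)
  have "ereal (norm x) < fps_conv_radius (F ^ k)"
    using rad fps_conv_radius_power[of F k] by (rule less_le_trans)
  then have "(\<lambda>j. fps_nth (F ^ k) j * x ^ j) sums eval_fps (F ^ k) x" by (rule sums_eval_fps)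
  moreover have "eval_fps (F ^ k) x = g_fun a x ^ k"
    using eval_fps_power[OF rad] by (simp add: eval_fps_def F_def g_fun_def)
  moreover have "fps_nth (F ^ k) j = of_int (pcoef (\<lambda>j. \<bar>a j\<bar>) k j)" for j
    by (simp only: F_def fps_nth_power_of_int)
  ultimately have "(\<lambda>j. of_int (pcoef (\<lambda>j. \<bar>a j\<bar>) k j) * x ^ j) sums g_fun a x ^ k" by simp
  then show ?thesis
    by (rule sums_nonneg_imp_has_sum) (use x in \<open>auto intro!: mult_nonneg_nonneg simp: pcoef_abs_nonneg\<close>)
qed

lemma has_sum_pcoef:
  assumes z: "ereal (norm z) < rho_c a"
  shows "((\<lambda>j. of_int (pcoef a k j) * z ^ j) has_sum f_fun a z ^ k) UNIV"
proof -
  define F :: "complex fps" where "F = Abs_fps (\<lambda>j. of_int (a j))"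
  have "conv_radius (fps_nth F) = conv_radius (\<lambda>j. norm (of_int (a j) :: complex))"
    by (simp only: conv_radius_norm) (simp add: F_def)
  then have rad: "ereal (norm z) < fps_conv_radius F"
    using z by (simp add: fps_conv_radius_def rho_c_def)
  then have rad': "ereal (norm z) < fps_conv_radius (F ^ k)"
    using fps_conv_radius_power[of F k] by (rule less_le_trans)
  have "((\<lambda>j. fps_nth (F ^ k) j * z ^ j) has_sum eval_fps (F ^ k) z) UNIV"
    by (rule norm_summable_imp_has_sum[OF norm_summable_fps[OF rad'] sums_eval_fps[OF rad']])
  moreover have "eval_fps (F ^ k) z = f_fun a z ^ k"
    using eval_fps_power[OF rad] by (simp add: eval_fps_def F_def f_fun_def)
  ultimately show ?thesis by (simp only: F_def fps_nth_power_of_int)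
qed

lemma g_fun_nonneg:
  assumes "0 \<le> x" "ereal x < rho_c a"
  shows "0 \<le> g_fun a x"
  using has_sum_nonneg[OF has_sum_pcoef_abs[OF assms, of 1]] assms
  by (simp add: pcoef_abs_nonneg)

lemma norm_f_fun_le:
  assumes "ereal (norm z) < rho_c a"
  shows "norm (f_fun a z) \<le> g_fun a (norm z)"
proof (rule norm_infsum_le)
  show "((\<lambda>j. of_int (a j) * z ^ j) has_sum f_fun a z) UNIV"
    using has_sum_pcoef[OF assms, of 1] by (simp add: pcoef_1)
  show "((\<lambda>j. of_int \<bar>a j\<bar> * norm z ^ j) has_sum g_fun a (norm z)) UNIV"
    using has_sum_pcoef_abs[of "norm z" a 1] assms by (simp add: pcoef_1)
qed (simp add: norm_mult norm_power)

lemma g_fun_mono: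
  assumes "0 \<le> x" "x \<le> y" "ereal y < rho_c a"
  shows "g_fun a x \<le> g_fun a y"
proof (rule has_sum_mono)
  have "ereal x < rho_c a" using assms(2,3) by (meson ereal_less_eq(3) le_less_trans)
  then show "((\<lambda>j. of_int \<bar>a j\<bar> * x ^ j) has_sum g_fun a x) UNIV"
    using has_sum_pcoef_abs[of x a 1] assms by (simp add: pcoef_1)
  show "((\<lambda>j. of_int \<bar>a j\<bar> * y ^ j) has_sum g_fun a y) UNIV"
    using has_sum_pcoef_abs[of y a 1] assms by (simp add: pcoef_1)
qed (use assms in \<open>auto intro!: mult_left_mono power_mono\<close>)

lemma has_sum_Ln_one_minus:
  fixes w :: complex
  assumes "norm w < 1"
  shows "((\<lambda>m. - (w ^ m) / of_nat m) has_sum Ln (1 - w)) {1..}"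
proof -
  have "((\<lambda>m. - (w ^ m) / of_nat m) has_sum Ln (1 - w)) UNIV"
  proof (rule norm_summable_imp_has_sum)
    show "(\<lambda>m. - (w ^ m) / of_nat m) sums Ln (1 - w)"
      using Ln_series'[of "-w"] assms by simp
    show "summable (\<lambda>m. norm (- (w ^ m) / of_nat m))"
    proof (rule summable_comparison_test')
      show "summable (\<lambda>m. norm w ^ m)" using assms by (simp add: summable_geometric)
      show "norm (norm (- (w ^ m) / of_nat m)) \<le> norm w ^ m" if "m \<ge> 1" for m
      proof -
        have "norm w ^ m / of_nat m \<le> norm w ^ m / 1"
          using that by (intro divide_left_mono) auto
        then show ?thesis by (simp add: norm_divide norm_power)
      qed
    qed
  qed
  \<comment> \<open>The term m = 0 may be dropped, since 1 / 0 = 0.\<close>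
  then show ?thesis
    by (rule has_sum_cong_neutral[THEN iffD1, rotated -1]) auto
qed

lemma norm_Ln_one_minus_le:
  fixes w :: complex
  assumes "norm w \<le> \<theta>" "\<theta> < 1"
  shows "norm (Ln (1 - w)) \<le> norm w / (1 - \<theta>)"
proof -
  have w: "norm w < 1" using assms by simp
  have "norm (Ln (1 - w)) \<le> norm w / (1 - norm w)"
  proof (rule norm_infsum_le)
    show "((\<lambda>m. - (w ^ m) / of_nat m) has_sum Ln (1 - w)) {1..}"
      using w by (rule has_sum_Ln_one_minus)
    show "((\<lambda>m. norm w ^ m) has_sum norm w / (1 - norm w)) {1..}"
      using has_sum_geometric_from_1[of "norm w"] w by simp
    show "norm (- (w ^ m) / of_nat m) \<le> norm w ^ m" if "m \<in> {1..}" for m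
    proof -
      have "norm w ^ m / of_nat m \<le> norm w ^ m / 1"
        using that by (intro divide_left_mono) auto
      then show ?thesis by (simp add: norm_divide norm_power)
    qed
  qed
  also have "\<dots> \<le> norm w / (1 - \<theta>)" using assms by (intro divide_left_mono) auto
  finally show ?thesis .
qed

section \<open>Logarithms of the factors and their majorant\<close>

definition log_factor :: "(nat \<Rightarrow> int) \<Rightarrow> complex \<Rightarrow> complex \<Rightarrow> nat \<Rightarrow> nat \<Rightarrow> complex" where
  "log_factor a z y k j = of_int (h_int a j k) * Ln (1 - z ^ j * y ^ k)"

text \<open>The terms of the expansion of the geometric series in g(x) t: summing over j gives (g(x)
  t)^k. By \<open>abs_h_int_le\<close> they dominate |h(j,k)| x^j t^k.\<close>

definition majorant :: "(nat \<Rightarrow> int) \<Rightarrow> real \<Rightarrow> real \<Rightarrow> nat \<Rightarrow> nat \<Rightarrow> real" where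
  "majorant a x t k j = of_int (pcoef (\<lambda>j. \<bar>a j\<bar>) k j) * x ^ j * t ^ k"

lemma majorant_nonneg: "0 \<le> x \<Longrightarrow> 0 \<le> t \<Longrightarrow> 0 \<le> majorant a x t k j"
  by (simp add: majorant_def pcoef_abs_nonneg)

lemma has_sum_majorant_inner:
  assumes "0 \<le> x" "ereal x < rho_c a"
  shows "(majorant a x t k has_sum (g_fun a x * t) ^ k) UNIV"
  unfolding majorant_def power_mult_distrib
  by (rule has_sum_cmult_left) (rule has_sum_pcoef_abs[OF assms])

lemma has_sum_majorant:
  assumes x: "0 \<le> x" "ereal x < rho_c a" and t: "0 \<le> t" and less: "g_fun a x * t < 1"
  shows "((\<lambda>(k, j). majorant a x t k j) has_sum (g_fun a x * t / (1 - g_fun a x * t))) ({1..} \<times> UNIV)"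
proof -
  let ?\<theta> = "g_fun a x * t"
  have "0 \<le> ?\<theta>" using g_fun_nonneg[OF x] t by simp
  then have geo: "((\<lambda>k. ?\<theta> ^ k) has_sum (?\<theta> / (1 - ?\<theta>))) {1..}"
    using less by (intro has_sum_geometric_from_1) simp
  show ?thesis
  proof (rule has_sum_SigmaI[where g = "\<lambda>k. ?\<theta> ^ k"])
    show "(\<lambda>(k, j). majorant a x t k j) summable_on ({1..} \<times> UNIV)"
      by (rule summable_on_SigmaI[where g = "\<lambda>k. ?\<theta> ^ k"])
        (use has_sum_majorant_inner[OF x] has_sum_imp_summable[OF geo] majorant_nonneg[OF x(1) t] in auto)
  qed (use has_sum_majorant_inner[OF x] geo in auto)
qed

lemma majorant_le:
  assumes "0 \<le> x" "ereal x < rho_c a" "0 \<le> t"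
  shows "majorant a x t k j \<le> (g_fun a x * t) ^ k"
  using finite_sum_le_has_sum[OF has_sum_majorant_inner[OF assms(1,2), of t k], of "{j}"]
    majorant_nonneg[OF assms(1,3)] by simp

lemma abs_h_int_le:
  assumes "a 0 = 0" "j0 a \<ge> 1" "k \<ge> 1"
  shows "\<bar>h_int a j k\<bar> \<le> pcoef (\<lambda>j. \<bar>a j\<bar>) k j"
proof -
  have "of_int \<bar>h_int a j k\<bar> \<le> (of_int (pcoef (\<lambda>j. \<bar>a j\<bar>) k j) :: rat)"
    using abs_h_coeff_le[OF assms(3), of a j] of_int_h_int[OF assms, of j] by simp
  then show ?thesis by linarith
qed

text \<open>Where $h(j,k) \neq 0$ the majorant has integer coefficient at least $1$, so $|z^j y^k|$ is
  controlled even when $|z| \ge 1$, which happens for polynomial $f$.\<close>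
lemma norm_monomial_le:
  fixes z y :: complex
  assumes "a 0 = 0" "j0 a \<ge> 1" "k \<ge> 1" and h: "h_int a j k \<noteq> 0"
    and z: "ereal (norm z) < rho_c a" and less: "g_fun a (norm z) * norm y < 1"
  shows "norm (z ^ j * y ^ k) \<le> g_fun a (norm z) * norm y"
proof -
  let ?\<theta> = "g_fun a (norm z) * norm y"
  have \<theta>: "0 \<le> ?\<theta>" using g_fun_nonneg[of "norm z" a] z by simp
  have "1 * norm (z ^ j * y ^ k) \<le> of_int (pcoef (\<lambda>j. \<bar>a j\<bar>) k j) * norm (z ^ j * y ^ k)"
    using abs_h_int_le[OF assms(1-3), of j] h by (intro mult_right_mono) auto
  also have "\<dots> = majorant a (norm z) (norm y) k j"
    by (simp add: majorant_def norm_mult norm_power)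
  also have "\<dots> \<le> ?\<theta> ^ k" using z by (intro majorant_le) auto
  also have "\<dots> \<le> ?\<theta> ^ 1" using \<theta> less assms(3) by (intro power_decreasing) auto
  finally show ?thesis by simp
qed

lemma norm_log_factor_le:
  assumes "a 0 = 0" "j0 a \<ge> 1" "k \<ge> 1"
    and z: "ereal (norm z) < rho_c a" and less: "g_fun a (norm z) * norm y < 1"
  shows "norm (log_factor a z y k j) \<le> majorant a (norm z) (norm y) k j / (1 - g_fun a (norm z) * norm y)"
proof (cases "h_int a j k = 0")
  case True
  then show ?thesis using less majorant_nonneg[of "norm z" "norm y" a k j] by (simp add: log_factor_def)
next
  case False
  let ?\<theta> = "g_fun a (norm z) * norm y" and ?w = "z ^ j * y ^ k"
  have "norm (log_factor a z y k j) \<le> of_int \<bar>h_int a j k\<bar> * (norm ?w / (1 - ?\<theta>))"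
    unfolding log_factor_def norm_mult norm_of_int
    using norm_Ln_one_minus_le[OF norm_monomial_le[OF assms(1-3) False z less] less]
    by (intro mult_mono) (auto simp: norm_mult)
  also have "\<dots> \<le> of_int (pcoef (\<lambda>j. \<bar>a j\<bar>) k j) * (norm ?w / (1 - ?\<theta>))"
    using abs_h_int_le[OF assms(1-3), of j] less by (intro mult_right_mono) auto
  finally show ?thesis by (simp add: majorant_def norm_mult norm_power)
qed

lemma cfactor_eq_exp:
  assumes "a 0 = 0" "j0 a \<ge> 1" "k \<ge> 1"
    and z: "ereal (norm z) < rho_c a" and less: "g_fun a (norm z) * norm y < 1"
  shows "cfactor a z y k j = exp (log_factor a z y k j)"
proof (cases "h_int a j k = 0")
  case False
  have "z ^ j * y ^ k \<noteq> 1"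
    using norm_monomial_le[OF assms(1-3) False z less] less by auto
  then show ?thesis by (simp add: cfactor_def log_factor_def flip: exp_power_int)
qed (simp add: cfactor_def log_factor_def)

lemma h_int_eq_0:
  assumes "k \<ge> 1" "j < k * j0 a"
  shows "h_int a j k = 0"
  using h_coeff_eq_0[OF assms] by (simp add: h_int_def)

text \<open>Expand every logarithm into its power series and collect the coefficient of $z^n y^r$, which
  is $-\frac1r [z^n] f(z)^r$.\<close>
lemma has_sum_log_factor:
  assumes a: "a 0 = 0" "j0 a \<ge> 1"
    and z: "ereal (norm z) < rho_c a" and less: "g_fun a (norm z) * norm y < 1"
  shows "((\<lambda>(k, j). log_factor a z y k j) has_sum Ln (1 - y * f_fun a z)) ({1..} \<times> UNIV)"
proof -
  define \<theta> where "\<theta> = g_fun a (norm z) * norm y"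
  have \<theta>: "0 \<le> \<theta>" "\<theta> < 1" using g_fun_nonneg[of "norm z" a] z less by (auto simp: \<theta>_def)
  define \<tau> where "\<tau> = (\<lambda>((k, j), m). of_int (h_int a j k) * (- ((z ^ j * y ^ k) ^ m) / of_nat m) :: complex)"
  define B where "B = (\<lambda>(k, j). majorant a (norm z) (norm y) k j)"
  have B_nonneg: "0 \<le> B x" for x by (cases x) (simp add: B_def majorant_nonneg)
  \<comment> \<open>One factor |z^j y^k| of its m-th power is kept to form the majorant together
    with |h(j,k)|; the other m - 1 are bounded by \<theta>, giving a geometric series in m.\<close>
  have "(\<lambda>(x, m). B x * \<theta> ^ (m - 1)) summable_on (({1..} \<times> UNIV) \<times> {1..})"
  proof (rule summable_on_SigmaI)
    fix x :: "nat \<times> nat"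
    have "((\<lambda>m. \<theta> ^ m) has_sum (1 / (1 - \<theta>))) UNIV"
      using \<theta> by (intro norm_summable_imp_has_sum geometric_sums) (auto simp: summable_geometric)
    then have "((\<lambda>m. \<theta> ^ (m - 1)) has_sum (1 / (1 - \<theta>))) {1..}"
      by (subst has_sum_reindex_bij_witness[of _ Suc "\<lambda>m. m - 1" UNIV "\<lambda>m. \<theta> ^ m"]) auto
    then show "((\<lambda>m. case (x, m) of (x, m) \<Rightarrow> B x * \<theta> ^ (m - 1)) has_sum (B x * (1 / (1 - \<theta>)))) {1..}"
      by (simp only: prod.case) (rule has_sum_cmult_right)
  next
    show "(\<lambda>x. B x * (1 / (1 - \<theta>))) summable_on ({1..} \<times> UNIV)"
      using has_sum_imp_summable[OF has_sum_majorant[of "norm z" a "norm y"]] z less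
      by (intro summable_on_cmult_left) (simp add: B_def)
  qed (use B_nonneg \<theta> in auto)
  then have "(\<lambda>x. norm (\<tau> x)) summable_on (({1..} \<times> UNIV) \<times> {1..})"
  proof (rule Infinite_Sum.abs_summable_on_comparison_test')
    fix x :: "(nat \<times> nat) \<times> nat" assume x: "x \<in> ({1..} \<times> UNIV) \<times> {1..}"
    obtain k j m where [simp]: "x = ((k, j), m)" by (metis surj_pair)
    have km: "k \<ge> 1" "m \<ge> 1" using x by auto
    show "norm (\<tau> x) \<le> (case x of (x, m) \<Rightarrow> B x * \<theta> ^ (m - 1))"
    proof (cases "h_int a j k = 0")
      case True
      then show ?thesis using B_nonneg \<theta> by (simp add: \<tau>_def)
    next
      case False
      let ?w = "z ^ j * y ^ k"
      have w: "norm ?w \<le> \<theta>" unfolding \<theta>_def by (rule norm_monomial_le[OF a km(1) False z less])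
      have "norm ?w ^ m / of_nat m \<le> norm ?w ^ m / 1" using km by (intro divide_left_mono) auto
      also have "\<dots> = norm ?w * norm ?w ^ (m - 1)" using km by (cases m) auto
      also have "\<dots> \<le> norm ?w * \<theta> ^ (m - 1)" using w by (intro mult_left_mono power_mono) auto
      finally have 1: "norm (- (?w ^ m) / of_nat m) \<le> norm ?w * \<theta> ^ (m - 1)"
        by (simp only: norm_divide norm_minus_cancel norm_power norm_of_nat)
      have "norm (\<tau> x) = of_int \<bar>h_int a j k\<bar> * norm (- (?w ^ m) / of_nat m)"
        by (simp add: \<tau>_def norm_mult norm_divide)
      also have "\<dots> \<le> of_int (pcoef (\<lambda>j. \<bar>a j\<bar>) k j) * (norm ?w * \<theta> ^ (m - 1))"
        using abs_h_int_le[OF a km(1), of j] by (intro mult_mono 1) (auto simp: pcoef_abs_nonneg)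
      finally show ?thesis by (simp add: B_def majorant_def norm_mult norm_power)
    qed
  qed
  then have "\<tau> summable_on (({1..} \<times> UNIV) \<times> {1..})" by (rule abs_summable_summable)
  then obtain S where S: "(\<tau> has_sum S) (({1..} \<times> UNIV) \<times> {1..})" by (auto simp: summable_on_def)
  have "((\<lambda>x. case x of (k, j) \<Rightarrow> log_factor a z y k j) has_sum S) ({1..} \<times> UNIV)"
  proof (rule has_sum_SigmaD[OF S])
    fix x :: "nat \<times> nat" assume x: "x \<in> {1..} \<times> UNIV"
    obtain k j where [simp]: "x = (k, j)" by force
    show "((\<lambda>m. \<tau> (x, m)) has_sum (case x of (k, j) \<Rightarrow> log_factor a z y k j)) {1..}"
    proof (cases "h_int a j k = 0")
      case False
      have "norm (z ^ j * y ^ k) < 1"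
        using norm_monomial_le[OF a _ False z less] x less by auto
      then have "((\<lambda>m. of_int (h_int a j k) * (- ((z ^ j * y ^ k) ^ m) / of_nat m)) has_sum
          of_int (h_int a j k) * Ln (1 - z ^ j * y ^ k)) {1..}"
        by (intro has_sum_cmult_right has_sum_Ln_one_minus)
      then show ?thesis by (simp only: \<tau>_def log_factor_def prod.case \<open>x = (k, j)\<close>)
    qed (simp add: \<tau>_def log_factor_def)
  qed
  moreover have "S = Ln (1 - y * f_fun a z)"
  proof -
    define D where "D = (\<lambda>(r::nat, n::nat). {m. m dvd r \<and> m dvd n})"
    define \<tau>' where "\<tau>' = (\<lambda>((r, n), m). - (of_int (h_int a (n div m) (r div m)) / of_nat m * (z ^ n * y ^ r)) :: complex)"
    define \<phi> where "\<phi> = (\<lambda>((k, j), m). ((k * m, j * m), m) :: (nat \<times> nat) \<times> nat)"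
    define \<psi> where "\<psi> = (\<lambda>((r, n), m). ((r div m, n div m), m) :: (nat \<times> nat) \<times> nat)"
    \<comment> \<open>Reindexing (k, j, m) to (r, n, m) = (k m, j m, m): the fibre over (r, n) is
      the finite set of common divisors, to which \<open>sum_h_coeff_divisors\<close>
      applies.\<close>
    have "(\<tau>' has_sum S) (Sigma ({1..} \<times> UNIV) D)"
    proof (subst has_sum_reindex_bij_witness[where i = \<phi> and j = \<psi> and T = "({1..} \<times> UNIV) \<times> {1..}" and h = \<tau>])
      show "(\<tau> has_sum S) (({1..} \<times> UNIV) \<times> {1..})" by (rule S)
    next
      fix x assume "x \<in> Sigma ({1..} \<times> UNIV) D"
      then obtain r n m where x: "x = ((r, n), m)" "m dvd r" "m dvd n" "r \<ge> 1"
        by (auto simp: D_def)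
      then obtain k j where kj: "r = k * m" "n = j * m" by (auto elim!: dvdE simp: mult.commute)
      have "m \<ge> 1" "k \<ge> 1" using x kj by (auto simp: Suc_le_eq)
      then show "\<phi> (\<psi> x) = x" "\<psi> x \<in> ({1..} \<times> UNIV) \<times> {1..}" "\<tau> (\<psi> x) = \<tau>' x"
        by (auto simp: x kj \<tau>_def \<tau>'_def \<phi>_def \<psi>_def power_mult_distrib power_mult)
    next
      fix x :: "(nat \<times> nat) \<times> nat" assume "x \<in> ({1..} \<times> UNIV) \<times> {1..}"
      then show "\<psi> (\<phi> x) = x" "\<phi> x \<in> Sigma ({1..} \<times> UNIV) D"
        by (auto simp: D_def \<phi>_def \<psi>_def Suc_le_eq)
    qed auto
    then have "((\<lambda>(r, n). of_int (pcoef a r n) * z ^ n * (- (y ^ r) / of_nat r)) has_sum S) ({1..} \<times> UNIV)"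
    proof (rule has_sum_SigmaD)
      fix x :: "nat \<times> nat" assume x: "x \<in> {1..} \<times> UNIV"
      obtain r n where [simp]: "x = (r, n)" by force
      have r: "r \<ge> 1" using x by simp
      have fin: "finite (D x)" using r by (simp add: D_def)
      have "(\<Sum>m\<in>D x. of_int (h_int a (n div m) (r div m)) / of_nat m :: rat) = of_int (pcoef a r n) / of_nat r"
        unfolding sum_h_coeff_divisors[OF r, symmetric]
      proof (rule sum.cong)
        fix m assume "m \<in> {m. m dvd r \<and> m dvd n}"
        then have "r div m \<ge> 1" using r by (auto elim!: dvdE simp: Suc_le_eq)
        then show "of_int (h_int a (n div m) (r div m)) / of_nat m = h_coeff a (n div m) (r div m) / of_nat m"
          by (simp only: of_int_h_int[OF a])
      qed (simp add: D_def)
      \<comment> \<open>The divisor identity lives in the rationals and is carried to the complex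
        numbers by \<open>of_rat\<close>.\<close>
      then have "of_rat (\<Sum>m\<in>D x. of_int (h_int a (n div m) (r div m)) / of_nat m) = (of_rat (of_int (pcoef a r n) / of_nat r) :: complex)"
        by (simp only:)
      then have "(\<Sum>m\<in>D x. of_int (h_int a (n div m) (r div m)) / of_nat m) = (of_int (pcoef a r n) / of_nat r :: complex)"
        by (simp add: of_rat_sum of_rat_divide)
      then have "(\<Sum>m\<in>D x. \<tau>' (x, m)) = - (of_int (pcoef a r n) / of_nat r * (z ^ n * y ^ r))"
        by (simp only: \<tau>'_def prod.case \<open>x = (r, n)\<close> sum_negf sum_distrib_right[symmetric])
      then have "(\<Sum>m\<in>D x. \<tau>' (x, m)) = (case x of (r, n) \<Rightarrow> of_int (pcoef a r n) * z ^ n * (- (y ^ r) / of_nat r))"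
        by simp
      then show "((\<lambda>m. \<tau>' (x, m)) has_sum (case x of (r, n) \<Rightarrow> of_int (pcoef a r n) * z ^ n * (- (y ^ r) / of_nat r))) (D x)"
        using has_sum_finite[OF fin, of "\<lambda>m. \<tau>' (x, m)"] by simp
    qed
    then have "((\<lambda>r. f_fun a z ^ r * (- (y ^ r) / of_nat r)) has_sum S) {1..}"
      by (rule has_sum_SigmaD) (simp only: prod.case, intro has_sum_cmult_left has_sum_pcoef z)
    then have "((\<lambda>r. - ((y * f_fun a z) ^ r) / of_nat r) has_sum S) {1..}"
      by (simp add: power_mult_distrib mult_ac)
    \<comment> \<open>The resulting series in r is the logarithm series itself, so uniqueness of
      sums gives the principal value exactly, with no multiple of 2 pi i left open.\<close>
    moreover have "norm (y * f_fun a z) < 1"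
    proof -
      have "norm (y * f_fun a z) \<le> norm y * g_fun a (norm z)"
        unfolding norm_mult by (intro mult_left_mono norm_f_fun_le z) simp
      then show ?thesis using less by (simp add: mult.commute)
    qed
    then have "((\<lambda>r. - ((y * f_fun a z) ^ r) / of_nat r) has_sum Ln (1 - y * f_fun a z)) {1..}"
      by (rule has_sum_Ln_one_minus)
    ultimately show ?thesis by (rule has_sum_unique)
  qed
  ultimately show ?thesis by simp
qed

section \<open>From sums of logarithms to iterated products\<close>

lemma has_prod_exp:
  fixes f :: "nat \<Rightarrow> complex"
  assumes "f sums s"
  shows "(\<lambda>i. exp (f i)) has_prod exp s"
  using sums_imp_has_prod_exp[OF assms] by (simp add: has_prod_def)

lemma has_sum_from_1_imp_sums:
  fixes f :: "nat \<Rightarrow> complex"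
  assumes "(f has_sum s) {1..}"
  shows "(\<lambda>i. f (i + 1)) sums s"
proof -
  have "((\<lambda>i. f (i + 1)) has_sum s) UNIV"
    using assms by (subst has_sum_reindex_bij_witness[of _ "\<lambda>i. i - 1" "\<lambda>i. i + 1" "{1..}" f]) auto
  then show ?thesis by (rule has_sum_imp_sums)
qed

text \<open>Unconditional summation over pairs may be carried out row by row, and exp turns the row
  sums into the inner products. Starting a row at j = k J changes nothing because M vanishes before
  it. Parts (ii) and (iii) both end here.\<close>

lemma has_prod_double_exp:
  fixes M :: "nat \<Rightarrow> nat \<Rightarrow> complex"
  assumes S: "((\<lambda>(k, j). M k j) has_sum S) ({1..} \<times> UNIV)"
    and zero: "\<And>k j. k \<ge> 1 \<Longrightarrow> j < k * J \<Longrightarrow> M k j = 0"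
    and F: "\<And>k j. k \<ge> 1 \<Longrightarrow> j \<ge> k * J \<Longrightarrow> F k j = exp (M k j)"
  shows "\<exists>P. (\<forall>k\<ge>1. (\<lambda>i. F k (i + k * J)) has_prod P k) \<and> (\<lambda>i. P (i + 1)) has_prod exp S"
proof (intro exI conjI allI impI)
  define L where "L = (\<lambda>k. infsum (M k) UNIV)"
  have inner: "(M k has_sum L k) UNIV" if "k \<ge> 1" for k
    using summable_on_SigmaD1[OF has_sum_imp_summable[OF S], of k] that by (simp add: L_def)
  show "(\<lambda>i. F k (i + k * J)) has_prod exp (L k)" if k: "k \<ge> 1" for k
  proof -
    have "(\<lambda>i. M k (i + k * J)) sums L k"
      using has_sum_imp_sums[OF inner[OF k]] sums_zero_iff_shift[of "k * J" "M k" "L k"] zero[OF k] by simp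
    then have "(\<lambda>i. exp (M k (i + k * J))) has_prod exp (L k)" by (rule has_prod_exp)
    then show ?thesis using F[OF k] by simp
  qed
  have "(L has_sum S) {1..}"
    by (rule has_sum_SigmaD[OF S]) (use inner in auto)
  then show "(\<lambda>i. exp (L (i + 1))) has_prod exp S"
    by (intro has_prod_exp has_sum_from_1_imp_sums)
qed

theorem analytic_product_identity:
  assumes a: "a 0 = 0" "j0 a \<ge> 1"
    and z: "ereal (norm z) < rho_c a" and less: "g_fun a (norm z) * norm y < 1"
  shows "(\<lambda>(k, j). norm (cfactor a z y k j - 1)) summable_on {(k, j). k \<ge> 1 \<and> j \<ge> k * j0 a}"
    and "\<exists>P. (\<forall>k\<ge>1. (\<lambda>i. cfactor a z y k (i + k * j0 a)) has_prod P k) \<and>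
           (\<lambda>i. P (i + 1)) has_prod (1 - y * f_fun a z)"
proof -
  define \<theta> where "\<theta> = g_fun a (norm z) * norm y"
  have \<theta>: "0 \<le> \<theta>" "\<theta> < 1" using g_fun_nonneg[of "norm z" a] z less by (auto simp: \<theta>_def)
  \<comment> \<open>From |exp l - 1| <= exp |Re l| * |l|, with |l| at most the majorant divided by 1
    - \<theta>, and the majorant itself at most 1.\<close>
  define C where "C = exp (1 / (1 - \<theta>)) / (1 - \<theta>)"
  let ?B = "majorant a (norm z) (norm y)"
  have "(\<lambda>(k, j). ?B k j) summable_on ({1..} \<times> UNIV)"
    using has_sum_imp_summable[OF has_sum_majorant[of "norm z" a "norm y"]] z less by simp
  then have "(\<lambda>x. (case x of (k, j) \<Rightarrow> ?B k j) * C) summable_on ({1..} \<times> UNIV)"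
    by (rule summable_on_cmult_left)
  then have "(\<lambda>x. norm (case x of (k, j) \<Rightarrow> cfactor a z y k j - 1)) summable_on ({1..} \<times> UNIV)"
  proof (rule Infinite_Sum.abs_summable_on_comparison_test')
    fix x :: "nat \<times> nat" assume x: "x \<in> {1..} \<times> UNIV"
    obtain k j where [simp]: "x = (k, j)" by force
    have k: "k \<ge> 1" using x by simp
    let ?l = "log_factor a z y k j"
    have l: "norm ?l \<le> ?B k j / (1 - \<theta>)"
      unfolding \<theta>_def by (rule norm_log_factor_le[OF a k z less])
    have "?B k j \<le> \<theta> ^ k" unfolding \<theta>_def using z by (intro majorant_le) auto
    also have "\<dots> \<le> 1" using \<theta> by (intro power_le_one) auto
    finally have l1: "norm ?l \<le> 1 / (1 - \<theta>)"
      using l \<theta> by (meson divide_right_mono diff_ge_0_iff_ge less_imp_le order_trans)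
    have "norm (exp ?l - (\<Sum>i\<le>0. ?l ^ i / fact i)) \<le> exp \<bar>Re ?l\<bar> * norm ?l ^ Suc 0 / fact 0"
      by (rule Taylor_exp)
    then have "norm (exp ?l - 1) \<le> exp \<bar>Re ?l\<bar> * norm ?l" by simp
    also have "\<dots> \<le> exp (1 / (1 - \<theta>)) * (?B k j / (1 - \<theta>))"
      using abs_Re_le_cmod[of ?l] l l1 by (intro mult_mono) auto
    finally show "norm (case x of (k, j) \<Rightarrow> cfactor a z y k j - 1) \<le> (case x of (k, j) \<Rightarrow> ?B k j) * C"
      by (simp add: C_def cfactor_eq_exp[OF a k z less] mult.commute)
  qed
  then show "(\<lambda>(k, j). norm (cfactor a z y k j - 1)) summable_on {(k, j). k \<ge> 1 \<and> j \<ge> k * j0 a}"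
    by (rule summable_on_subset[THEN summable_on_cong[THEN iffD1, rotated]]) auto
  have "1 - y * f_fun a z \<noteq> 0"
  proof
    assume "1 - y * f_fun a z = 0"
    then have "1 = norm y * norm (f_fun a z)" by (metis eq_iff_diff_eq_0 norm_mult norm_one)
    also have "\<dots> \<le> norm y * g_fun a (norm z)" by (intro mult_left_mono norm_f_fun_le z) simp
    finally show False using less by (simp add: mult.commute)
  qed
  then have "exp (Ln (1 - y * f_fun a z)) = 1 - y * f_fun a z" by simp
  then show "\<exists>P. (\<forall>k\<ge>1. (\<lambda>i. cfactor a z y k (i + k * j0 a)) has_prod P k) \<and>
           (\<lambda>i. P (i + 1)) has_prod (1 - y * f_fun a z)"
    using has_prod_double_exp[OF has_sum_log_factor[OF a z less], of "j0 a" "cfactor a z y"]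
    by (simp add: log_factor_def h_int_eq_0 cfactor_eq_exp[OF a _ z less])
qed

section \<open>Euler products\<close>

text \<open>The sieve of Eratosthenes: among the n free of primes in A, the multiples of a new prime
  p are exactly p times that same set, so removing them multiplies the sum by 1 - u p.\<close>

lemma has_sum_coprime_sieve:
  fixes u :: "nat \<Rightarrow> complex"
  assumes mult: "\<And>m n. u (m * n) = u m * u n"
    and S: "(u has_sum S) {1..}"
    and A: "finite A" "\<And>p. p \<in> A \<Longrightarrow> prime p"
  shows "(u has_sum (S * (\<Prod>p\<in>A. 1 - u p))) {n. n \<ge> 1 \<and> (\<forall>p\<in>A. \<not> p dvd n)}"
  using A
proof (induction A rule: finite_induct)
  case empty
  have "{n. n \<ge> 1 \<and> (\<forall>p\<in>{}. \<not> p dvd n)} = {1::nat..}" by auto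
  then show ?case using S by simp
next
  case (insert p A)
  let ?C = "{n. n \<ge> 1 \<and> (\<forall>q\<in>A. \<not> q dvd n)}"
  let ?D = "{n. n \<ge> 1 \<and> (\<forall>q\<in>insert p A. \<not> q dvd n)}"
  let ?T = "S * (\<Prod>q\<in>A. 1 - u q)"
  have IH: "(u has_sum ?T) ?C" using insert by simp
  have p: "prime p" using insert by simp
  have ndvd: "\<not> q dvd p" if "q \<in> A" for q
    using that insert by (metis insertCI primes_dvd_imp_eq)
  have bij: "bij_betw (\<lambda>n. p * n) ?C (?C - ?D)"
  proof (rule bij_betwI')
    fix n assume n: "n \<in> ?C"
    then show "p * n \<in> ?C - ?D"
      using p ndvd insert.prems prime_gt_0_nat[OF p] by (auto simp: prime_dvd_mult_iff Suc_le_eq)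
  next
    fix n assume n: "n \<in> ?C - ?D"
    then have "p dvd n" by auto
    then obtain m where m: "n = p * m" by (elim dvdE)
    then have "m \<in> ?C" using n by (auto simp: Suc_le_eq)
    then show "\<exists>m\<in>?C. n = p * m" using m by blast
  qed (use prime_gt_0_nat[OF p] in auto)
  have "((\<lambda>n. u p * u n) has_sum (u p * ?T)) ?C" by (rule has_sum_cmult_right[OF IH])
  then have "(u has_sum (u p * ?T)) (?C - ?D)"
    using has_sum_reindex_bij_betw[OF bij, of u "u p * ?T"] by (simp add: mult)
  then have "(u has_sum (?T - u p * ?T)) (?C - (?C - ?D))"
    by (intro has_sum_Diff[OF IH]) auto
  moreover have "?C - (?C - ?D) = ?D" by auto
  moreover have "?T - u p * ?T = S * (\<Prod>q\<in>insert p A. 1 - u q)"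
    using insert by (simp add: algebra_simps)
  ultimately show ?case by simp
qed

text \<open>After sieving by all primes below N, only n = 1 and certain n >= N remain, so the error
  is at most a tail of the sum of |u n|. Stating the limit for sum times product avoids presupposing
  that the sum is nonzero.\<close>

lemma prod_primes_tendsto:
  fixes u :: "nat \<Rightarrow> complex"
  assumes u1: "u 1 = 1" and mult: "\<And>m n. u (m * n) = u m * u n"
    and sum: "(\<lambda>n. norm (u n)) summable_on {1..}"
  shows "(\<lambda>N. infsum u {1..} * (\<Prod>p | prime p \<and> p < N. 1 - u p)) \<longlonglongrightarrow> 1"
proof -
  let ?S = "infsum u {1..}" and ?P = "\<lambda>N. \<Prod>p | prime p \<and> p < N. 1 - u p"
  define v where "v = (\<lambda>n. if n \<ge> 1 then norm (u n) else 0)"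
  have v: "v summable_on UNIV"
    by (rule summable_on_cong_neutral[THEN iffD1, OF _ _ _ sum]) (auto simp: v_def)
  then have vs: "summable v" by (rule summable_on_imp_summable)
  have S: "(u has_sum ?S) {1..}"
    using abs_summable_summable[OF sum] by simp
  have bound: "norm (?S * ?P N - 1) \<le> suminf v - sum v {..<N}" if N: "N \<ge> 2" for N
  proof -
    let ?C = "{n. n \<ge> 1 \<and> (\<forall>p\<in>{p. prime p \<and> p < N}. \<not> p dvd n)}"
    have C: "(u has_sum (?S * ?P N)) ?C"
      by (rule has_sum_coprime_sieve[OF mult S]) auto
    have "(u has_sum 1) {1}" using u1 by (intro has_sum_finiteI) auto
    then have diff: "(u has_sum (?S * ?P N - 1)) (?C - {1})"
      by (rule has_sum_Diff[OF C]) auto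
    have sub: "?C - {1} \<subseteq> {N..}"
    proof
      fix n assume n: "n \<in> ?C - {1}"
      then obtain p where p: "prime p" "p dvd n" using prime_factor_nat[of n] by auto
      have "N \<le> p" using n p by force
      also have "p \<le> n" using p n by (intro dvd_imp_le) auto
      finally show "n \<in> {N..}" by simp
    qed
    have "((\<lambda>n. v (n + N)) has_sum (suminf v - sum v {..<N})) UNIV"
      using suminf_minus_initial_segment[OF vs, of N] summable_ignore_initial_segment[OF vs, of N]
      by (intro sums_nonneg_imp_has_sum) (auto simp: sums_iff v_def)
    then have "(v has_sum (suminf v - sum v {..<N})) {N..}"
      by (subst has_sum_reindex_bij_witness[of _ "\<lambda>n. n + N" "\<lambda>n. n - N" UNIV "\<lambda>n. v (n + N)"]) auto
    have "norm (?S * ?P N - 1) \<le> infsum v (?C - {1})"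
    proof (rule norm_infsum_le[OF diff])
      show "(v has_sum infsum v (?C - {1})) (?C - {1})"
        using summable_on_subset[OF v] by simp
    qed (auto simp: v_def)
    also have "\<dots> \<le> infsum v {N..}"
      using summable_on_subset[OF v] sub by (intro infsum_mono2) (auto simp: v_def)
    also have "\<dots> = suminf v - sum v {..<N}"
      using \<open>(v has_sum (suminf v - sum v {..<N})) {N..}\<close> by (rule infsumI)
    finally show ?thesis .
  qed
  have "(\<lambda>N. suminf v - sum v {..<N}) \<longlonglongrightarrow> suminf v - suminf v"
    by (intro tendsto_diff tendsto_const summable_LIMSEQ[OF vs])
  then have "(\<lambda>N. suminf v - sum v {..<N}) \<longlonglongrightarrow> 0" by simp
  then have "(\<lambda>N. ?S * ?P N - 1) \<longlonglongrightarrow> 0"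
    by (rule Lim_null_comparison[rotated]) (use bound in \<open>auto simp: eventually_sequentially\<close>)
  then show ?thesis by (simp only: LIM_zero_iff)
qed

text \<open>The logarithmic form allows sums over primes to be exchanged with other sums, and the
  equation also shows that the Dirichlet sum is nonzero. The bound 1/2 keeps 1 - u p away from 0 and
  yields |Ln (1 - u p)| <= 2 |u p|.\<close>

theorem euler_product_exp:
  fixes u :: "nat \<Rightarrow> complex"
  assumes u1: "u 1 = 1" and mult: "\<And>m n. u (m * n) = u m * u n"
    and sum: "(\<lambda>n. norm (u n)) summable_on {1..}"
    and half: "\<And>n. n \<ge> 2 \<Longrightarrow> norm (u n) < 1 / 2"
  shows "(\<lambda>p. Ln (1 - u p)) summable_on {p. prime p}"
    and "infsum u {1..} * exp (infsum (\<lambda>p. Ln (1 - u p)) {p. prime p}) = 1"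
proof -
  have "(\<lambda>n. 2 * norm (u n)) summable_on {1..}" by (rule summable_on_cmult_right[OF sum])
  then have "(\<lambda>n. 2 * norm (u n)) summable_on {p. prime p}"
    by (rule summable_on_subset) (use prime_ge_1_nat in auto)
  then have "(\<lambda>p. norm (Ln (1 - u p))) summable_on {p. prime p}"
  proof (rule Infinite_Sum.abs_summable_on_comparison_test')
    fix p :: nat assume "p \<in> {p. prime p}"
    then have "norm (- u p) < 1 / 2" using half prime_ge_2_nat by auto
    then show "norm (Ln (1 - u p)) \<le> 2 * norm (u p)" using norm_Ln_le[of "- u p"] by simp
  qed
  then show *: "(\<lambda>p. Ln (1 - u p)) summable_on {p. prime p}" by (rule abs_summable_summable)
  let ?T = "infsum (\<lambda>p. Ln (1 - u p)) {p. prime p}"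
  define f where "f = (\<lambda>n. if prime n then Ln (1 - u n) else 0)"
  have "((\<lambda>p. Ln (1 - u p)) has_sum ?T) {p. prime p}" using * by simp
  then have "(f has_sum ?T) UNIV"
    by (rule has_sum_cong_neutral[THEN iffD1, rotated -1]) (auto simp: f_def)
  then have "f sums ?T" by (rule has_sum_imp_sums)
  then have "(\<lambda>N. exp (\<Sum>n<N. f n)) \<longlonglongrightarrow> exp ?T"
    unfolding sums_def by (rule tendsto_exp)
  moreover have "exp (\<Sum>n<N. f n) = (\<Prod>p | prime p \<and> p < N. 1 - u p)" for N
  proof -
    have "exp (\<Sum>n<N. f n) = (\<Prod>n<N. exp (f n))" by (simp add: exp_sum)
    also have "\<dots> = (\<Prod>p | prime p \<and> p < N. 1 - u p)"
    proof (rule prod.mono_neutral_cong_right)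
      fix p assume "p \<in> {p. prime p \<and> p < N}"
      then have "norm (u p) < 1 / 2" "prime p" using half prime_ge_2_nat by auto
      then have "1 - u p \<noteq> 0" by auto
      then show "exp (f p) = 1 - u p" using \<open>prime p\<close> by (simp add: f_def)
    qed (auto simp: f_def)
    finally show ?thesis .
  qed
  ultimately have "(\<lambda>N. infsum u {1..} * (\<Prod>p | prime p \<and> p < N. 1 - u p)) \<longlonglongrightarrow> infsum u {1..} * exp ?T"
    by (simp add: tendsto_mult_left)
  then show "infsum u {1..} * exp ?T = 1"
    using prod_primes_tendsto[OF u1 mult sum] by (rule LIMSEQ_unique)
qed

text \<open>If $\sum 1/p$ converged, the Euler products for $\zeta(s)$, $s > 1$, would be bounded
  uniformly in $s$, and so would the partial sums of the harmonic series.\<close>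
lemma not_summable_prime_reciprocals:
  "\<not> summable (\<lambda>n. if prime n then 1 / real n else 0)"
proof
  assume sum: "summable (\<lambda>n. if prime n then 1 / real n else 0)"
  have "(\<lambda>n. if prime n then 1 / real n else 0) summable_on UNIV"
    by (rule summable_nonneg_imp_summable_on[OF sum]) auto
  then have primes: "(\<lambda>p. 1 / real p) summable_on {p. prime p}"
    by (rule summable_on_cong_neutral[THEN iffD1, rotated -1]) auto
  \<comment> \<open>A bound on |log zeta(s)| independent of s, as |Ln (1 - p^(-s))| <= 2 p^(-s) <= 2
    / p.\<close>
  define C where "C = infsum (\<lambda>p. 2 * (1 / real p)) {p. prime p}"
  have zeta: "(\<Sum>n=1..M. real n powr - s) \<le> exp C" if s: "s > 1" for s :: real and M :: nat
  proof -
    define u :: "nat \<Rightarrow> complex" where "u = (\<lambda>n. of_real (real n powr - s))"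
    have norm_u: "norm (u n) = real n powr - s" for n by (simp add: u_def)
    have "(\<lambda>n. real n powr - s) summable_on UNIV"
      using s by (intro summable_nonneg_imp_summable_on) (auto simp: summable_real_powr_iff)
    then have sum_u: "(\<lambda>n. norm (u n)) summable_on {1..}"
      unfolding norm_u by (rule summable_on_subset) simp
    have half: "norm (u n) < 1 / 2" if "n \<ge> 2" for n
    proof -
      have "real n powr - s \<le> 2 powr - s"
        using that s by (intro powr_mono2') auto
      also have "\<dots> < 2 powr - 1" using s by (intro powr_less_mono) auto
      finally show ?thesis by (simp add: norm_u powr_minus)
    qed
    have u1: "u 1 = 1" and mult: "\<And>m n. u (m * n) = u m * u n"
      by (simp_all add: u_def powr_mult)
    note euler = euler_product_exp[OF u1 mult sum_u half]
    let ?T = "infsum (\<lambda>p. Ln (1 - u p)) {p. prime p}"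
    have "norm ?T \<le> C"
    proof (rule norm_infsum_le)
      show "((\<lambda>p. Ln (1 - u p)) has_sum ?T) {p. prime p}" using euler(1) by simp
      show "((\<lambda>p. 2 * (1 / real p)) has_sum C) {p. prime p}"
        unfolding C_def using summable_on_cmult_right[OF primes, of 2] by simp
      fix p :: nat assume p: "p \<in> {p. prime p}"
      then have "p \<ge> 2" by (simp add: prime_ge_2_nat)
      then have "norm (Ln (1 - u p)) \<le> 2 * norm (u p)"
        using norm_Ln_le[of "- u p"] half[of p] by simp
      also have "\<dots> \<le> 2 * (real p powr - 1)"
        unfolding norm_u using s \<open>p \<ge> 2\<close> by (intro mult_left_mono powr_mono) auto
      finally show "norm (Ln (1 - u p)) \<le> 2 * (1 / real p)"
        using \<open>p \<ge> 2\<close> by (simp add: powr_minus divide_inverse)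
    qed
    have "infsum u {1..} = exp (- ?T)"
      using euler(2) by (simp add: exp_minus field_simps)
    then have "norm (infsum u {1..}) \<le> exp (norm (- ?T))" by (simp only: norm_exp)
    also have "\<dots> \<le> exp C" using \<open>norm ?T \<le> C\<close> by simp
    finally have le: "norm (infsum u {1..}) \<le> exp C" .
    have real_sum: "((\<lambda>n. real n powr - s) has_sum infsum (\<lambda>n. real n powr - s) {1..}) {1..}"
      using sum_u unfolding norm_u by simp
    then have "(u has_sum of_real (infsum (\<lambda>n. real n powr - s) {1..})) {1..}"
      unfolding u_def by (rule has_sum_of_real)
    then have eq: "infsum u {1..} = of_real (infsum (\<lambda>n. real n powr - s) {1..})" by (rule infsumI)
    have "(\<Sum>n=1..M. real n powr - s) \<le> infsum (\<lambda>n. real n powr - s) {1..}"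
      by (rule finite_sum_le_has_sum[OF real_sum]) auto
    also have "\<dots> \<le> norm (infsum u {1..})" unfolding eq by simp
    finally show ?thesis using le by simp
  qed
  \<comment> \<open>For a fixed number of terms, s may tend to 1 from the right.\<close>
  have harm: "(\<Sum>n=1..M. 1 / real n) \<le> exp C" for M
  proof (rule tendsto_upperbound)
    show "((\<lambda>s. \<Sum>n=1..M. real n powr - s) \<longlongrightarrow> (\<Sum>n=1..M. 1 / real n)) (at_right 1)"
    proof (rule tendsto_sum)
      fix n assume "n \<in> {1..M}"
      then have n: "real n > 0" by simp
      have "((\<lambda>s. real n powr - s) \<longlongrightarrow> real n powr - 1) (at_right 1)"
        using n by (intro tendsto_powr tendsto_const tendsto_minus tendsto_ident_at) auto
      then show "((\<lambda>s. real n powr - s) \<longlongrightarrow> 1 / real n) (at_right 1)"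
        using n by (simp add: powr_minus divide_inverse)
    qed
    show "\<forall>\<^sub>F s in at_right 1. (\<Sum>n=1..M. real n powr - s) \<le> exp C"
      using zeta by (auto simp: eventually_at_right_field intro!: exI[of _ 2])
  qed simp
  have "summable (\<lambda>n. 1 / real (Suc n))"
  proof (rule summableI_nonneg_bounded)
    show "(\<Sum>i<n. 1 / real (Suc i)) \<le> exp C" for n
      using harm[of n] by (simp add: sum.atLeast1_atMost_eq)
  qed simp
  then have "summable (\<lambda>n. inverse (real n))"
    by (subst summable_Suc_iff[symmetric]) (simp add: divide_inverse)
  then show False using not_summable_harmonic[where 'a = real] by simp
qed

text \<open>Periodicity leaves finitely many values, and multiplicativity makes every power of chi n
  a value again; a value of norm above 1 would have unbounded powers.\<close>

lemma dirichlet_character_norm_le_1: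
  assumes "dirichlet_character q chi"
  shows "norm (chi n) \<le> 1"
proof (rule ccontr)
  assume "\<not> norm (chi n) \<le> 1"
  have q: "q \<ge> 1" and per: "\<And>n. chi (n + q) = chi n"
    and mult: "\<And>m n. chi (m * n) = chi m * chi n" and one: "chi 1 = 1"
    using assms by (auto simp: dirichlet_character_def)
  have per': "chi (n + q * i) = chi n" for n i
  proof (induction i)
    case (Suc i)
    have "chi (n + q * Suc i) = chi ((n + q * i) + q)" by (simp add: algebra_simps)
    then show ?case using per Suc by metis
  qed simp
  have "chi m \<in> chi ` {..<q}" for m
  proof -
    have "chi m = chi (m mod q + q * (m div q))" by simp
    then have "chi m = chi (m mod q)" by (simp only: per')
    then show ?thesis using q by auto
  qed
  then have bound: "norm (chi m) \<le> Max (norm ` chi ` {..<q})" for m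
    by (intro Max_ge) auto
  have pow: "chi (n ^ i) = chi n ^ i" for i by (induction i) (auto simp: mult one[simplified])
  obtain i where "Max (norm ` chi ` {..<q}) < norm (chi n) ^ i"
    using \<open>\<not> norm (chi n) \<le> 1\<close> real_arch_pow[of "norm (chi n)"] by auto
  also have "\<dots> = norm (chi (n ^ i))" by (simp add: pow norm_power)
  also have "\<dots> \<le> Max (norm ` chi ` {..<q})" by (rule bound)
  finally show False by simp
qed

text \<open>Intended for powers of a character, of which only complete multiplicativity and the
  bound 1 are used. The condition s >= 2 gives absolute convergence and |u n| <= 1/4 for n >=
  2.\<close>

lemma exp_sum_log_eq_L_fun:
  fixes \<psi> :: "nat \<Rightarrow> complex"
  assumes one: "\<psi> 1 = 1" and mult: "\<And>m n. \<psi> (m * n) = \<psi> m * \<psi> n" and le: "\<And>n. norm (\<psi> n) \<le> 1"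
    and s: "s \<ge> 2"
  shows "(\<lambda>p. Ln (1 - (1 / of_nat p) ^ s * \<psi> p)) summable_on {p. prime p}"
    and "exp (infsum (\<lambda>p. Ln (1 - (1 / of_nat p) ^ s * \<psi> p)) {p. prime p}) = inverse (L_fun s \<psi>)"
proof -
  define u where "u = (\<lambda>n. (1 / of_nat n) ^ s * \<psi> n)"
  have norm_u: "norm (u n) \<le> (1 / real n) ^ s" for n
  proof -
    have "norm (u n) = (1 / real n) ^ s * norm (\<psi> n)" by (simp add: u_def norm_mult norm_power norm_divide)
    also have "\<dots> \<le> (1 / real n) ^ s * 1" using le by (intro mult_left_mono) auto
    finally show ?thesis by simp
  qed
  have u1: "u 1 = 1" and u_mult: "u (m * n) = u m * u n" for m n
    using one by (simp_all add: u_def mult power_mult_distrib power_divide)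
  have "summable (\<lambda>n. (1 / real n) ^ s)"
    using inverse_power_summable[OF s, where 'a = real] by (simp add: power_one_over inverse_eq_divide)
  then have "(\<lambda>n. (1 / real n) ^ s) summable_on UNIV"
    by (rule summable_nonneg_imp_summable_on) auto
  then have "(\<lambda>n. (1 / real n) ^ s) summable_on {1..}" by (rule summable_on_subset) simp
  then have sum_u: "(\<lambda>n. norm (u n)) summable_on {1..}"
    by (rule Infinite_Sum.abs_summable_on_comparison_test') (rule norm_u)
  have half: "norm (u n) < 1 / 2" if "n \<ge> 2" for n
  proof -
    have "(1 / real n) ^ s \<le> (1 / 2) ^ s" using that by (intro power_mono) (auto simp: field_simps)
    also have "\<dots> \<le> (1 / 2) ^ 2" using s by (intro power_decreasing) auto
    finally show ?thesis using norm_u[of n] by (simp add: power2_eq_square)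
  qed
  note euler = euler_product_exp[OF u1 u_mult sum_u half]
  show "(\<lambda>p. Ln (1 - (1 / of_nat p) ^ s * \<psi> p)) summable_on {p. prime p}"
    using euler(1) by (simp add: u_def)
  have "(\<lambda>n. u (n + 1)) sums infsum u {1..}"
    by (rule has_sum_from_1_imp_sums) (use abs_summable_summable[OF sum_u] in simp)
  then have "L_fun s \<psi> = infsum u {1..}"
    by (simp add: L_fun_def sums_iff u_def power_divide)
  then show "exp (infsum (\<lambda>p. Ln (1 - (1 / of_nat p) ^ s * \<psi> p)) {p. prime p}) = inverse (L_fun s \<psi>)"
    using euler(2) by (simp add: u_def inverse_unique[symmetric])
qed

theorem euler_product_identity:
  assumes a: "a 0 = 0" "\<exists>j. a j \<noteq> 0"
    and rho: "rho_c a > ereal (1/2)" and g: "g_fun a (1/2) < 1"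
    and sum_g: "summable (\<lambda>n. if prime n then g_fun a (1 / real n) else 0)"
    and chi: "dirichlet_character q chi"
  shows "\<exists>P Q. (\<forall>k\<ge>1. (\<lambda>i. L_fun (i + k * j0 a) (\<lambda>n. chi n ^ k) powi (- h_int a (i + k * j0 a) k)) has_prod P k) \<and>
     (\<lambda>i. P (i + 1)) has_prod Q \<and>
     (\<lambda>n. if prime n then 1 - chi n * f_fun a (1 / of_nat n) else 1) has_prod Q"
proof -
  have j0_1: "j0 a \<ge> 1" using a by (rule j0_pos)
  \<comment> \<open>A bound for g(1/p) |chi p| that is uniform over all primes, since 1/p <= 1/2 and
    g is increasing.\<close>
  define \<theta> where "\<theta> = g_fun a (1/2)"
  have \<theta>: "0 \<le> \<theta>" "\<theta> < 1" using g g_fun_nonneg[of "1/2" a] rho by (auto simp: \<theta>_def)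
  have inv_le: "1 / real p \<le> 1 / 2" if "prime p" for p
    using prime_ge_2_nat[OF that] by (simp add: field_simps)
  have inv_rho: "ereal (1 / real p) < rho_c a" if "prime p" for p
    using inv_le[OF that] rho by (meson ereal_less_eq(3) le_less_trans)
  have g_p: "0 \<le> g_fun a (1 / real p)" "g_fun a (1 / real p) \<le> \<theta>" if "prime p" for p
    unfolding \<theta>_def using inv_rho[OF that] inv_le[OF that] rho
    by (auto intro!: g_fun_nonneg g_fun_mono)
  have "(\<lambda>n. if prime n then g_fun a (1 / real n) else 0) summable_on UNIV"
    by (rule summable_nonneg_imp_summable_on[OF sum_g]) (auto simp: g_p)
  then have sum_g': "(\<lambda>p. g_fun a (1 / real p)) summable_on {p. prime p}"
    by (rule summable_on_cong_neutral[THEN iffD1, rotated -1]) auto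

  \<comment> \<open>If a(1) were nonzero, then |a(1)| >= 1 would give g(1/p) >= 1/p, contradicting
    the divergence of the sum of 1/p.\<close>
  have j0_2: "j0 a \<ge> 2"
  proof (rule ccontr)
    assume "\<not> j0 a \<ge> 2"
    then have "j0 a = 1" using j0_1 by simp
    then have a1: "a 1 \<noteq> 0" using LeastI_ex[OF a(2)] by (simp add: j0_def)
    have "1 / real p \<le> g_fun a (1 / real p)" if p: "prime p" for p
    proof -
      have "1 / real p \<le> of_int \<bar>a 1\<bar> * (1 / real p)"
        using a1 mult_right_mono[of 1 "of_int \<bar>a 1\<bar>" "1 / real p"] by simp
      also have "\<dots> = majorant a (1 / real p) 1 1 1" by (simp add: majorant_def pcoef_1)
      also have "\<dots> \<le> g_fun a (1 / real p)"
        using majorant_le[of "1 / real p" a 1 1 1] inv_rho[OF p] by simp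
      finally show ?thesis .
    qed
    then have "summable (\<lambda>n. if prime n then 1 / real n else 0)"
      by (intro summable_comparison_test'[OF sum_g, of 0]) auto
    then show False using not_summable_prime_reciprocals by simp
  qed

  have chi_le: "norm (chi n) \<le> 1" for n by (rule dirichlet_character_norm_le_1[OF chi])
  have chi_mult: "chi (m * n) = chi m * chi n" and chi_1: "chi 1 = 1" for m n
    using chi by (auto simp: dirichlet_character_def)
  define z where "z = (\<lambda>p::nat. 1 / of_nat p :: complex)"
  have norm_z: "norm (z p) = 1 / real p" for p by (simp add: z_def norm_divide)
  have less: "g_fun a (norm (z p)) * norm (chi p) \<le> \<theta>" if "prime p" for p
  proof -
    have "g_fun a (norm (z p)) * norm (chi p) \<le> \<theta> * 1"
      unfolding norm_z using g_p[OF that] chi_le \<theta> by (intro mult_mono) auto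
    then show ?thesis by simp
  qed
  have z_rho: "ereal (norm (z p)) < rho_c a" if "prime p" for p
    unfolding norm_z by (rule inv_rho[OF that])

  define v where "v = (\<lambda>(p, (k, j)). log_factor a (z p) (chi p) k j)"
  let ?K = "{1::nat..} \<times> (UNIV :: nat set)"
  \<comment> \<open>With |chi p| replaced by 1, the sum over (k, j) is g / (1 - g) at 1/p. One
    factor 1/(1 - \<theta>) comes from the logarithm estimate, the other from bounding 1 - g below;
    what is left is the convergent sum of g(1/p).\<close>
  have "(\<lambda>(p, (k, j)). majorant a (1 / real p) 1 k j / (1 - \<theta>)) summable_on ({p. prime p} \<times> ?K)"
  proof (rule summable_on_SigmaI)
    fix p :: nat assume "p \<in> {p. prime p}"
    then have p: "prime p" by simp
    let ?g = "g_fun a (1 / real p)"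
    have "((\<lambda>x. (case x of (k, j) \<Rightarrow> majorant a (1 / real p) 1 k j) / (1 - \<theta>)) has_sum (?g / (1 - ?g) / (1 - \<theta>))) ?K"
      using has_sum_majorant[of "1 / real p" a 1] inv_rho[OF p] g_p[OF p] \<theta>
      by (intro has_sum_divide_const) auto
    then show "((\<lambda>y. case (p, y) of (p, (k, j)) \<Rightarrow> majorant a (1 / real p) 1 k j / (1 - \<theta>)) has_sum (?g / (1 - ?g) / (1 - \<theta>))) ?K"
      by (simp add: case_prod_unfold)
  next
    have "(\<lambda>p. g_fun a (1 / real p) * (1 / (1 - \<theta>) / (1 - \<theta>))) summable_on {p. prime p}"
      by (rule summable_on_cmult_left[OF sum_g'])
    then show "(\<lambda>p. g_fun a (1 / real p) / (1 - g_fun a (1 / real p)) / (1 - \<theta>)) summable_on {p. prime p}"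
    proof (rule summable_on_comparison_test)
      fix p :: nat assume "p \<in> {p. prime p}"
      then have p: "prime p" by simp
      have "g_fun a (1 / real p) / (1 - g_fun a (1 / real p)) \<le> g_fun a (1 / real p) / (1 - \<theta>)"
        using g_p[OF p] \<theta> by (intro divide_left_mono mult_pos_pos) auto
      then have "g_fun a (1 / real p) / (1 - g_fun a (1 / real p)) / (1 - \<theta>) \<le> g_fun a (1 / real p) / (1 - \<theta>) / (1 - \<theta>)"
        using \<theta> by (intro divide_right_mono) auto
      then show "g_fun a (1 / real p) / (1 - g_fun a (1 / real p)) / (1 - \<theta>) \<le> g_fun a (1 / real p) * (1 / (1 - \<theta>) / (1 - \<theta>))"
        by simp
      show "0 \<le> g_fun a (1 / real p) / (1 - g_fun a (1 / real p)) / (1 - \<theta>)"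
        using g_p[OF p] \<theta> by auto
    qed
  next
    fix p :: nat and y :: "nat \<times> nat"
    show "0 \<le> (case (p, y) of (p, (k, j)) \<Rightarrow> majorant a (1 / real p) 1 k j / (1 - \<theta>))"
      using \<theta> by (auto simp: case_prod_unfold majorant_nonneg)
  qed
  then have "(\<lambda>x. norm (v x)) summable_on ({p. prime p} \<times> ?K)"
  proof (rule Infinite_Sum.abs_summable_on_comparison_test')
    fix x :: "nat \<times> nat \<times> nat" assume "x \<in> {p. prime p} \<times> ?K"
    then obtain p k j where x: "x = (p, (k, j))" "prime p" "k \<ge> 1" by auto
    have lt: "g_fun a (norm (z p)) * norm (chi p) < 1" using less[OF x(2)] \<theta> by simp
    have "norm (v x) \<le> majorant a (norm (z p)) (norm (chi p)) k j / (1 - g_fun a (norm (z p)) * norm (chi p))"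
      using norm_log_factor_le[OF a(1) j0_1 x(3) z_rho[OF x(2)] lt] by (simp add: v_def x)
    also have "\<dots> \<le> majorant a (norm (z p)) 1 k j / (1 - \<theta>)"
    proof (rule frac_le)
      show "majorant a (norm (z p)) (norm (chi p)) k j \<le> majorant a (norm (z p)) 1 k j"
        unfolding majorant_def using chi_le
        by (intro mult_left_mono power_mono mult_nonneg_nonneg) (auto simp: pcoef_abs_nonneg)
    qed (use \<theta> less[OF x(2)] in \<open>auto simp: majorant_nonneg\<close>)
    finally show "norm (v x) \<le> (case x of (p, (k, j)) \<Rightarrow> majorant a (1 / real p) 1 k j / (1 - \<theta>))"
      by (simp add: x norm_z)
  qed
  then have "v summable_on ({p. prime p} \<times> ?K)" by (rule abs_summable_summable)
  then obtain S where S: "(v has_sum S) ({p. prime p} \<times> ?K)" by (auto simp: summable_on_def)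

  have nz: "1 - chi p * f_fun a (z p) \<noteq> 0" if "prime p" for p
  proof
    assume "1 - chi p * f_fun a (z p) = 0"
    then have "1 = norm (f_fun a (z p)) * norm (chi p)" by (metis eq_iff_diff_eq_0 mult.commute norm_mult norm_one)
    also have "\<dots> \<le> g_fun a (norm (z p)) * norm (chi p)"
      by (intro mult_right_mono norm_f_fun_le z_rho that) simp
    finally show False using less[OF that] \<theta> by simp
  qed
  have "((\<lambda>p. Ln (1 - chi p * f_fun a (z p))) has_sum S) {p. prime p}"
  proof (rule has_sum_SigmaD[OF S])
    fix p :: nat assume "p \<in> {p. prime p}"
    then have p: "prime p" by simp
    have "g_fun a (norm (z p)) * norm (chi p) < 1" using less[OF p] \<theta> by simp
    then show "((\<lambda>y. v (p, y)) has_sum Ln (1 - chi p * f_fun a (z p))) ?K"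
      using has_sum_log_factor[OF a(1) j0_1 z_rho[OF p]] by (simp add: v_def)
  qed
  then have "((\<lambda>n. if prime n then Ln (1 - chi n * f_fun a (z n)) else 0) has_sum S) UNIV"
    by (rule has_sum_cong_neutral[THEN iffD1, rotated -1]) auto
  then have "(\<lambda>n. exp (if prime n then Ln (1 - chi n * f_fun a (z n)) else 0)) has_prod exp S"
    by (intro has_prod_exp has_sum_imp_sums)
  also have "(\<lambda>n. exp (if prime n then Ln (1 - chi n * f_fun a (z n)) else 0)) =
      (\<lambda>n. if prime n then 1 - chi n * f_fun a (1 / of_nat n) else 1)"
    using nz by (auto simp: z_def fun_eq_iff)
  finally have prod_p: "(\<lambda>n. if prime n then 1 - chi n * f_fun a (1 / of_nat n) else 1) has_prod exp S" .

  \<comment> \<open>Summing over p first yields a logarithm of the (k, j) factor on the L-series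
    side; summing over (k, j) first yielded the logarithm of the factor at p. Both orders give S, so
    both products equal exp S.\<close>
  define M where "M = (\<lambda>k j. infsum (\<lambda>p. log_factor a (z p) (chi p) k j) {p. prime p})"
  have S': "((\<lambda>(x, p). v (p, x)) has_sum S) (?K \<times> {p. prime p})"
    using S by (subst (asm) has_sum_swap)
  have M: "((\<lambda>(k, j). M k j) has_sum S) ?K"
  proof (rule has_sum_SigmaD[OF S'])
    fix x assume x: "x \<in> ?K"
    have "(\<lambda>p. v (p, x)) summable_on {p. prime p}"
      using summable_on_SigmaD1[of "\<lambda>x p. v (p, x)", OF has_sum_imp_summable[OF S'] x] .
    then show "((\<lambda>p. case (x, p) of (x, p) \<Rightarrow> v (p, x)) has_sum (case x of (k, j) \<Rightarrow> M k j)) {p. prime p}"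
      by (cases x) (simp add: M_def v_def)
  qed
  have "L_fun j (\<lambda>n. chi n ^ k) powi (- h_int a j k) = exp (M k j)" if k: "k \<ge> 1" and j: "j \<ge> k * j0 a" for k j
  proof -
    have "2 \<le> k * j0 a" using mult_le_mono[OF k j0_2] by simp
    then have j2: "j \<ge> 2" using j by simp
    have "norm (chi n ^ k) \<le> 1" for n
      using chi_le[of n] by (simp add: norm_power power_le_one)
    then have L: "(\<lambda>p. Ln (1 - (1 / of_nat p) ^ j * chi p ^ k)) summable_on {p. prime p}"
        "exp (infsum (\<lambda>p. Ln (1 - (1 / of_nat p) ^ j * chi p ^ k)) {p. prime p}) = inverse (L_fun j (\<lambda>n. chi n ^ k))"
      using exp_sum_log_eq_L_fun[of "\<lambda>n. chi n ^ k" j] j2 chi_1 chi_mult by (auto simp: power_mult_distrib)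
    have "M k j = of_int (h_int a j k) * infsum (\<lambda>p. Ln (1 - (1 / of_nat p) ^ j * chi p ^ k)) {p. prime p}"
      unfolding M_def log_factor_def z_def by (rule infsum_cmult_right[OF L(1)])
    then have "exp (M k j) = inverse (L_fun j (\<lambda>n. chi n ^ k)) powi h_int a j k"
      by (simp only: exp_power_int[symmetric] L(2))
    then show ?thesis by (simp add: power_int_minus power_int_inverse)
  qed
  then have "\<exists>P. (\<forall>k\<ge>1. (\<lambda>i. L_fun (i + k * j0 a) (\<lambda>n. chi n ^ k) powi (- h_int a (i + k * j0 a) k)) has_prod P k) \<and>
     (\<lambda>i. P (i + 1)) has_prod exp S"
    using has_prod_double_exp[OF M, of "j0 a" "\<lambda>k j. L_fun j (\<lambda>n. chi n ^ k) powi (- h_int a j k)"]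
    by (simp add: M_def log_factor_def h_int_eq_0)
  then show ?thesis using prod_p by blast
qed

theorem mainTheorem19:
  fixes a :: "nat \<Rightarrow> int"
  assumes a0: "a 0 = 0"
    and nonzero: "\<exists>j. a j \<noteq> 0"
  shows
    \<comment> \<open>(i) integrality and the formal identity (z-adic convergence in Q[[y]][[z]])\<close>
    "(\<forall>j k. k \<ge> 1 \<longrightarrow> h_coeff a j k \<in> \<int>) \<and>
     (\<exists>P :: nat \<Rightarrow> rat fps fps.
        (\<forall>k\<ge>1. (\<lambda>i. formal_factor a k (i + k * j0 a)) has_prod P k) \<and>
        (\<lambda>i. P (i + 1)) has_prod one_minus_yf a) \<and>
     \<comment> \<open>(ii) analytic identity with absolute convergence\<close>
     (\<forall>\<epsilon>>0. \<forall>y z :: complex.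
        ereal (norm z) < rho_c a \<and> g_fun a (norm z) * norm y < 1 - \<epsilon> \<longrightarrow>
        (\<lambda>(k, j). norm (cfactor a z y k j - 1)) summable_on {(k, j). k \<ge> 1 \<and> j \<ge> k * j0 a} \<and>
        (\<exists>P :: nat \<Rightarrow> complex.
           (\<forall>k\<ge>1. (\<lambda>i. cfactor a z y k (i + k * j0 a)) has_prod P k) \<and>
           (\<lambda>i. P (i + 1)) has_prod (1 - y * f_fun a z))) \<and>
     \<comment> \<open>(iii) Euler-product identity\<close>
     (rho_c a > ereal (1/2) \<and> g_fun a (1/2) < 1 \<and>
      summable (\<lambda>n. if prime n then g_fun a (1 / real n) else 0) \<longrightarrow>
      (\<forall>q chi. dirichlet_character q chi \<longrightarrow>
        (\<exists>P :: nat \<Rightarrow> complex. \<exists>Q.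
           (\<forall>k\<ge>1. (\<lambda>i. L_fun (i + k * j0 a) (\<lambda>n. chi n ^ k) powi (- h_int a (i + k * j0 a) k)) has_prod P k) \<and>
           (\<lambda>i. P (i + 1)) has_prod Q \<and>
           (\<lambda>n. if prime n then 1 - chi n * f_fun a (1 / of_nat n) else 1) has_prod Q)))"
proof (intro conjI impI allI)
  have j0: "j0 a \<ge> 1" using a0 nonzero by (rule j0_pos)
  show "h_coeff a j k \<in> \<int>" if "k \<ge> 1" for j k
    using a0 j0 that by (rule h_coeff_Ints)
  show "\<exists>P :: nat \<Rightarrow> rat fps fps.
        (\<forall>k\<ge>1. (\<lambda>i. formal_factor a k (i + k * j0 a)) has_prod P k) \<and>
        (\<lambda>i. P (i + 1)) has_prod one_minus_yf a"
    using a0 j0 by (rule formal_product_identity)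
  fix \<epsilon> :: real and y z :: complex
  assume "\<epsilon> > 0" and yz: "ereal (norm z) < rho_c a \<and> g_fun a (norm z) * norm y < 1 - \<epsilon>"
  then have less: "g_fun a (norm z) * norm y < 1" by simp
  show "(\<lambda>(k, j). norm (cfactor a z y k j - 1)) summable_on {(k, j). k \<ge> 1 \<and> j \<ge> k * j0 a}"
    and "\<exists>P :: nat \<Rightarrow> complex.
           (\<forall>k\<ge>1. (\<lambda>i. cfactor a z y k (i + k * j0 a)) has_prod P k) \<and>
           (\<lambda>i. P (i + 1)) has_prod (1 - y * f_fun a z)"
    by (rule analytic_product_identity[OF a0 j0 conjunct1[OF yz] less])+
next
  fix q and chi :: "nat \<Rightarrow> complex"
  assume "rho_c a > ereal (1/2) \<and> g_fun a (1/2) < 1 \<and>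
      summable (\<lambda>n. if prime n then g_fun a (1 / real n) else 0)"
    and "dirichlet_character q chi"
  then show "\<exists>P :: nat \<Rightarrow> complex. \<exists>Q.
           (\<forall>k\<ge>1. (\<lambda>i. L_fun (i + k * j0 a) (\<lambda>n. chi n ^ k) powi (- h_int a (i + k * j0 a) k)) has_prod P k) \<and>
           (\<lambda>i. P (i + 1)) has_prod Q \<and>
           (\<lambda>n. if prime n then 1 - chi n * f_fun a (1 / of_nat n) else 1) has_prod Q"
    using euler_product_identity[OF a0 nonzero] by blast
qed

end
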